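(* Consider the 18 non-abelian Painlevé-6 systems, numbered $(1),\dots,(18)$, $$\begin{aligned}z(z-1)u'&=p-\kappa_1u^2+\kappa_2u+z\big(q+\kappa_4u+\kappa_1-\kappa_2-\kappa_4\big),\\ z(z-1)v'&=r-\kappa_2v+z\big(s-v^2-\kappa_4v\big),\end{aligned}$$ depending on parameters $\kappa=(\kappa_1,\kappa_2,\kappa_3,\kappa_4)\in\mathbb{C}^4$, with $(p,q,r,s)$ listed in the context. The transformations $$r_1:\ (z,u,v)\mapsto(1-z,\,1-u,\,-v),\quad \kappa\mapsto(\kappa_1,\ 2\kappa_1-\kappa_2-\kappa_4,\ \kappa_3,\ \kappa_4),$$ $$r_2:\ (z,u,v)\mapsto(z^{-1},\,z^{-1}u,\,zv),\quad \kappa\mapsto(\kappa_1,\ \kappa_4-1,\ \kappa_3,\ \kappa_2+1),$$ and the transposition $\tau$ (reversing the order of factors in every monomial) act on this set of systems. The transformations $r_1,r_2$ generate a group isomorphic to $S_3$, $\tau$ commutes with them, and the whole group is isomorphic to $S_3\times\mathbb{Z}_2$. The action on the 18 systems is by the permutations $$r_1=(1\ 3)(13\ 14)(4\ 6)(16\ 18)(7\ 8)(9\ 12)(10\ 11),$$ $$r_2=(2\ 3)(14\ 15)(4\ 5)(16\ 17)(7\ 10)(8\ 12)(9\ 11),$$ $$\tau=(1\ 13)(2\ 15)(3\ 14)(4\ 16)(5\ 17)(6\ 18)(7\ 10)(8\ 11)(9\ 12),$$ and there are exactly three orbits: $\{1,2,3,13,14,15\}$, $\{4,5,6,16,17,18\}$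 and $\{7,8,9,10,11,12\}$.
   Context: Here $u,v$ are functions of $z$ with values in a unital associative $\mathbb{C}$-algebra (or formal non-commuting variables), $'=d/dz$. That $r_i$ maps system $(m)$ to system $(n)$ means: $(u(z),v(z))$ satisfies system $(m)$ with parameters $\kappa$ if and only if the transformed functions $\tilde u,\tilde v$ of the transformed variable $\tilde z$ satisfy system $(n)$ with the transformed parameters $\tilde\kappa$. That $\tau$ maps $(m)$ to $(n)$ means that reversing the order of the factors in every monomial of the right-hand sides of $(m)$ (same $\kappa$) gives $(n)$. Put $E_1=\tfrac12(\kappa_1+\kappa_3)uv+\tfrac12(3\kappa_1-\kappa_3)vu+\tfrac14(\kappa_3^2-\kappa_1^2)$, $E_2=2\kappa_1vu+\kappa_3$, $E_3=\kappa_1uv+\kappa_1vu+\kappa_3$, $E_4=\tfrac12(3\kappa_1-\kappa_3)uv+\tfrac12(\kappa_1+\kappa_3)vu+\tfrac14(\kappa_3^2-\kappa_1^2)$, $E_5=2\kappa_1uv+\kappa_3$. (1) $p=2uvu^2-uvu-vu^2$, $q=-uvu-vu^2+2vu$, $r=-vu^2v-2vuvu+vuv+v^2u+E_1$, $s=vuv+v^2u$. (2) $p=2uvu^2-uvu-vu^2$, $q=-2uvu+uv+vu$, $r=-vu^2v-2vuvu+vuv+v^2u+E_1$, $s=2vuv$. (3) $p=2uvu^2-2uvu$, $q=-uvu-vu^2+uv+vu$, $r=-vu^2v-2vuvu+2vuv+E_1$, $s=vuv+v^2u$. (4) $p=uvu^2+vu^3-2vu^2$, $q=-uvu-vu^2+2vu$,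 $r=-2vuvu-v^2u^2+2v^2u+E_2$, $s=vuv+v^2u$. (5) $p=uvu^2+vu^3-uvu-vu^2$, $q=-2vu^2+2vu$, $r=-2vuvu-v^2u^2+vuv+v^2u+E_2$, $s=2v^2u$. (6) $p=uvu^2+vu^3-uvu-vu^2$, $q=-uvu-vu^2+uv+vu$, $r=-2vuvu-v^2u^2+vuv+v^2u+E_2$, $s=vuv+v^2u$. For (7)–(12): $p=u^2vu+uvu^2+p_0$, $r=-uvuv-vu^2v-vuvu+r_0+E_3$ with (7) $p_0=-u^2v-uvu$, $q=-uvu-vu^2+uv+vu$, $r_0=uv^2+vuv$, $s=vuv+v^2u$. (8) $p_0=-2uvu$, $q=-uvu-vu^2+2vu$, $r_0=2vuv$, $s=vuv+v^2u$. (9) $p_0=-u^2v-uvu$, $q=-2uvu+2uv$, $r_0=uv^2+vuv$, $s=2vuv$. (10) $p_0=-uvu-vu^2$, $q=-u^2v-uvu+uv+vu$, $r_0=vuv+v^2u$, $s=uv^2+vuv$. (11) $p_0=-2uvu$, $q=-u^2v-uvu+2uv$, $r_0=2vuv$, $s=uv^2+vuv$. (12) $p_0=-uvu-vu^2$, $q=-2uvu+2vu$, $r_0=vuv+v^2u$, $s=2vuv$. (13) $p=2u^2vu-u^2v-uvu$, $q=-u^2v-uvu+2uv$, $r=-2uvuv-vu^2v+uv^2+vuv+E_4$, $s=uv^2+vuv$. (14) $p=2u^2vu-2uvu$, $q=-u^2v-uvu+uv+vu$, $r=-2uvuv-vu^2v+2vuv+E_4$, $s=uv^2+vuv$. (15)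 $p=2u^2vu-u^2v-uvu$, $q=-2uvu+uv+vu$, $r=-2uvuv-vu^2v+uv^2+vuv+E_4$, $s=2vuv$. (16) $p=u^3v+u^2vu-2u^2v$, $q=-u^2v-uvu+2uv$, $r=-u^2v^2-2uvuv+2uv^2+E_5$, $s=uv^2+vuv$. (17) $p=u^3v+u^2vu-u^2v-uvu$, $q=-2u^2v+2uv$, $r=-u^2v^2-2uvuv+uv^2+vuv+E_5$, $s=2uv^2$. (18) $p=u^3v+u^2vu-u^2v-uvu$, $q=-u^2v-uvu+uv+vu$, $r=-u^2v^2-2uvuv+uv^2+vuv+E_5$, $s=uv^2+vuv$. *)

theory Defs
  imports "HOL-Analysis.Analysis" "HOL-Algebra.Algebra" "HOL-Library.Poly_Mapping"
    "HOL-Combinatorics.Transposition"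
begin

section \<open>Formal non-commutative polynomials in two letters\<close>

datatype letter = U | V

datatype word = Word (letters: "letter list")

instantiation word :: monoid_add
begin

definition zero_word :: word where "zero_word = Word []"

definition plus_word :: "word \<Rightarrow> word \<Rightarrow> word" where
  "plus_word a b = Word (letters a @ letters b)"

instance
  by standard (simp_all add: zero_word_def plus_word_def)

end

text \<open>Since words form a (non-commutative) additive monoid under concatenation, the convolution
  product of \<^theory>\<open>HOL-Library.Poly_Mapping\<close> makes this type the free unital associative
  complex algebra on the letters U and V.\<close>

type_synonym ncpoly = "word \<Rightarrow>\<^sub>0 complex"

definition var :: "letter \<Rightarrow> ncpoly" where
  "var l = Poly_Mapping.single (Word [l]) 1"

definition cst :: "complex \<Rightarrow> ncpoly" where
  "cst c = Poly_Mapping.single 0 c"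

definition nc_scale :: "complex \<Rightarrow> ncpoly \<Rightarrow> ncpoly" where
  "nc_scale c f = cst c * f"

text \<open>Reversal is an involution on words, so reindexing by it reverses every monomial.\<close>

definition nc_rev :: "ncpoly \<Rightarrow> ncpoly" where
  "nc_rev = Poly_Mapping.map_key (\<lambda>w. Word (rev (letters w)))"

section \<open>Unital associative complex algebras\<close>

locale complex_algebra = vector_space scl
  for scl :: "complex \<Rightarrow> 'a::ring_1 \<Rightarrow> 'a" +
  assumes scale_mult_left: "scl c (x * y) = scl c x * y"
    and scale_mult_right: "scl c (x * y) = x * scl c y"

text \<open>A Hausdorff vector topology is what is needed to speak of d/dz for algebra-valued functions;
  multiplication is not required to be continuous.\<close>

locale topological_complex_algebra = complex_algebra scl
  for scl :: "complex \<Rightarrow> 'a::{ring_1, topological_ab_group_add, t2_space} \<Rightarrow> 'a" +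
  assumes continuous_scale: "continuous_on UNIV (\<lambda>(c, x). scl c x)"

definition has_complex_deriv ::
  "(complex \<Rightarrow> 'a::{ring_1, topological_space} \<Rightarrow> 'a) \<Rightarrow> (complex \<Rightarrow> 'a) \<Rightarrow> 'a \<Rightarrow> complex \<Rightarrow> bool" where
  "has_complex_deriv scl f D z \<longleftrightarrow>
     ((\<lambda>w. scl (inverse (w - z)) (f w - f z)) \<longlongrightarrow> D) (at z)"

definition nc_eval ::
  "(complex \<Rightarrow> 'a::ring_1 \<Rightarrow> 'a) \<Rightarrow> 'a \<Rightarrow> 'a \<Rightarrow> ncpoly \<Rightarrow> 'a" where
  "nc_eval scl x y f =
     (\<Sum>w\<in>Poly_Mapping.keys f. scl (Poly_Mapping.lookup f w)
        (prod_list (map (\<lambda>l. case l of U \<Rightarrow> x | V \<Rightarrow> y) (letters w))))"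

section \<open>The systems\<close>

type_synonym params = "complex \<times> complex \<times> complex \<times> complex"

text \<open>A system consists of the right-hand sides of its equations for z(z-1)u' and z(z-1)v',
  for all values of the parameters and of z.\<close>

type_synonym system = "params \<Rightarrow> complex \<Rightarrow> ncpoly \<times> ncpoly"

definition rev_system :: "system \<Rightarrow> system" where
  "rev_system S = (\<lambda>\<kappa> z. map_prod nc_rev nc_rev (S \<kappa> z))"

definition pqrs_table :: "params \<Rightarrow> (ncpoly \<times> ncpoly \<times> ncpoly \<times> ncpoly) list" where
  "pqrs_table \<kappa> = (let
      (\<kappa>1, \<kappa>2, \<kappa>3, \<kappa>4) = \<kappa>;
      u = var U;
      v = var V;
      E1 = cst ((\<kappa>1 + \<kappa>3) / 2) * u * v + cst ((3 * \<kappa>1 - \<kappa>3) / 2) * v * u + cst ((\<kappa>3^2 - \<kappa>1^2) / 4);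
      E2 = cst (2 * \<kappa>1) * v * u + cst \<kappa>3;
      E3 = cst \<kappa>1 * u * v + cst \<kappa>1 * v * u + cst \<kappa>3;
      E4 = cst ((3 * \<kappa>1 - \<kappa>3) / 2) * u * v + cst ((\<kappa>1 + \<kappa>3) / 2) * v * u + cst ((\<kappa>3^2 - \<kappa>1^2) / 4);
      E5 = cst (2 * \<kappa>1) * u * v + cst \<kappa>3;
      p7 = u^2 * v * u + u * v * u^2;
      r7 = - u * v * u * v - v * u^2 * v - v * u * v * u + E3
    in [
     \<comment> \<open>1\<close>
     (2 * u * v * u^2 - u * v * u - v * u^2,
      - u * v * u - v * u^2 + 2 * v * u,
      - v * u^2 * v - 2 * v * u * v * u + v * u * v + v^2 * u + E1,
      v * u * v + v^2 * u),
     \<comment> \<open>2\<close>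
     (2 * u * v * u^2 - u * v * u - v * u^2,
      - 2 * u * v * u + u * v + v * u,
      - v * u^2 * v - 2 * v * u * v * u + v * u * v + v^2 * u + E1,
      2 * v * u * v),
     \<comment> \<open>3\<close>
     (2 * u * v * u^2 - 2 * u * v * u,
      - u * v * u - v * u^2 + u * v + v * u,
      - v * u^2 * v - 2 * v * u * v * u + 2 * v * u * v + E1,
      v * u * v + v^2 * u),
     \<comment> \<open>4\<close>
     (u * v * u^2 + v * u^3 - 2 * v * u^2,
      - u * v * u - v * u^2 + 2 * v * u,
      - 2 * v * u * v * u - v^2 * u^2 + 2 * v^2 * u + E2,
      v * u * v + v^2 * u),
     \<comment> \<open>5\<close>
     (u * v * u^2 + v * u^3 - u * v * u - v * u^2,
      - 2 * v * u^2 + 2 * v * u,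
      - 2 * v * u * v * u - v^2 * u^2 + v * u * v + v^2 * u + E2,
      2 * v^2 * u),
     \<comment> \<open>6\<close>
     (u * v * u^2 + v * u^3 - u * v * u - v * u^2,
      - u * v * u - v * u^2 + u * v + v * u,
      - 2 * v * u * v * u - v^2 * u^2 + v * u * v + v^2 * u + E2,
      v * u * v + v^2 * u),
     \<comment> \<open>7\<close>
     (p7 - u^2 * v - u * v * u,
      - u * v * u - v * u^2 + u * v + v * u,
      r7 + u * v^2 + v * u * v,
      v * u * v + v^2 * u),
     \<comment> \<open>8\<close>
     (p7 - 2 * u * v * u,
      - u * v * u - v * u^2 + 2 * v * u,
      r7 + 2 * v * u * v,
      v * u * v + v^2 * u),
     \<comment> \<open>9\<close>
     (p7 - u^2 * v - u * v * u,
      - 2 * u * v * u + 2 * u * v,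
      r7 + u * v^2 + v * u * v,
      2 * v * u * v),
     \<comment> \<open>10\<close>
     (p7 - u * v * u - v * u^2,
      - (u^2 * v) - u * v * u + u * v + v * u,
      r7 + v * u * v + v^2 * u,
      u * v^2 + v * u * v),
     \<comment> \<open>11\<close>
     (p7 - 2 * u * v * u,
      - (u^2 * v) - u * v * u + 2 * u * v,
      r7 + 2 * v * u * v,
      u * v^2 + v * u * v),
     \<comment> \<open>12\<close>
     (p7 - u * v * u - v * u^2,
      - 2 * u * v * u + 2 * v * u,
      r7 + v * u * v + v^2 * u,
      2 * v * u * v),
     \<comment> \<open>13\<close>
     (2 * u^2 * v * u - u^2 * v - u * v * u,
      - (u^2 * v) - u * v * u + 2 * u * v,
      - 2 * u * v * u * v - v * u^2 * v + u * v^2 + v * u * v + E4,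
      u * v^2 + v * u * v),
     \<comment> \<open>14\<close>
     (2 * u^2 * v * u - 2 * u * v * u,
      - (u^2 * v) - u * v * u + u * v + v * u,
      - 2 * u * v * u * v - v * u^2 * v + 2 * v * u * v + E4,
      u * v^2 + v * u * v),
     \<comment> \<open>15\<close>
     (2 * u^2 * v * u - u^2 * v - u * v * u,
      - 2 * u * v * u + u * v + v * u,
      - 2 * u * v * u * v - v * u^2 * v + u * v^2 + v * u * v + E4,
      2 * v * u * v),
     \<comment> \<open>16\<close>
     (u^3 * v + u^2 * v * u - 2 * u^2 * v,
      - (u^2 * v) - u * v * u + 2 * u * v,
      - (u^2 * v^2) - 2 * u * v * u * v + 2 * u * v^2 + E5,
      u * v^2 + v * u * v),
     \<comment> \<open>17\<close>
     (u^3 * v + u^2 * v * u - u^2 * v - u * v * u,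
      - 2 * u^2 * v + 2 * u * v,
      - (u^2 * v^2) - 2 * u * v * u * v + u * v^2 + v * u * v + E5,
      2 * u * v^2),
     \<comment> \<open>18\<close>
     (u^3 * v + u^2 * v * u - u^2 * v - u * v * u,
      - (u^2 * v) - u * v * u + u * v + v * u,
      - (u^2 * v^2) - 2 * u * v * u * v + u * v^2 + v * u * v + E5,
      u * v^2 + v * u * v)])"

text \<open>Only the values for m between 1 and 18 are meaningful.\<close>

definition P6 :: "nat \<Rightarrow> system" where
  "P6 m = (\<lambda>\<kappa> z. let
      (\<kappa>1, \<kappa>2, \<kappa>3, \<kappa>4) = \<kappa>;
      (p, q, r, s) = pqrs_table \<kappa> ! (m - 1);
      u = var U;
      v = var V
    in (p - cst \<kappa>1 * u^2 + cst \<kappa>2 * u + cst z * (q + cst \<kappa>4 * u + cst (\<kappa>1 - \<kappa>2 - \<kappa>4)),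
        r - cst \<kappa>2 * v + cst z * (s - v^2 - cst \<kappa>4 * v)))"

text \<open>Differentiability on \<open>\<Omega>\<close> is part of being a solution. It is only used for open \<open>\<Omega>\<close>
  that avoid 0 and 1.\<close>

definition solves ::
  "(complex \<Rightarrow> 'a::{ring_1, topological_space} \<Rightarrow> 'a) \<Rightarrow> system \<Rightarrow> params \<Rightarrow> complex set \<Rightarrow>
   (complex \<Rightarrow> 'a) \<Rightarrow> (complex \<Rightarrow> 'a) \<Rightarrow> bool" where
  "solves scl S \<kappa> \<Omega> u v \<longleftrightarrow>
     (\<forall>z\<in>\<Omega>. \<exists>u' v'. has_complex_deriv scl u u' z \<and> has_complex_deriv scl v v' z \<and>
        scl (z * (z - 1)) u' = nc_eval scl (u z) (v z) (fst (S \<kappa> z)) \<and>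
        scl (z * (z - 1)) v' = nc_eval scl (u z) (v z) (snd (S \<kappa> z)))"

section \<open>The transformations\<close>

type_synonym 'a point = "complex \<times> 'a \<times> 'a \<times> params"

definition points :: "'a point set" where
  "points = {(z, u, v, \<kappa>). z \<noteq> 0 \<and> z \<noteq> 1}"

text \<open>Elements of \<^const>\<open>BijGroup\<close> have to be undefined outside the underlying set, hence the
  restrictions.\<close>

definition r1 :: "(complex \<Rightarrow> 'a::ring_1 \<Rightarrow> 'a) \<Rightarrow> 'a point \<Rightarrow> 'a point" where
  "r1 scl = (\<lambda>(z, u, v, \<kappa>1, \<kappa>2, \<kappa>3, \<kappa>4) \<in> points.
     (1 - z, 1 - u, - v, \<kappa>1, 2*\<kappa>1 - \<kappa>2 - \<kappa>4, \<kappa>3, \<kappa>4))"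

definition r2 :: "(complex \<Rightarrow> 'a::ring_1 \<Rightarrow> 'a) \<Rightarrow> 'a point \<Rightarrow> 'a point" where
  "r2 scl = (\<lambda>(z, u, v, \<kappa>1, \<kappa>2, \<kappa>3, \<kappa>4) \<in> points.
     (inverse z, scl (inverse z) u, scl z v, \<kappa>1, \<kappa>4 - 1, \<kappa>3, \<kappa>2 + 1))"

definition transposition :: "ncpoly point \<Rightarrow> ncpoly point" where
  "transposition = (\<lambda>(z, u, v, \<kappa>) \<in> points. (z, nc_rev u, nc_rev v, \<kappa>))"

definition solution_graph ::
  "complex set \<Rightarrow> (complex \<Rightarrow> 'a) \<Rightarrow> (complex \<Rightarrow> 'a) \<Rightarrow> params \<Rightarrow> 'a point set" where
  "solution_graph \<Omega> u v \<kappa> = (\<lambda>z. (z, u z, v z, \<kappa>)) ` \<Omega>"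

text \<open>The transformed functions \<open>u'\<close> and \<open>v'\<close> of the transformed variable, their domain \<open>\<Omega>'\<close> and the
  transformed parameters are those whose graph is the image of the original graph.\<close>

definition maps_system ::
  "(complex \<Rightarrow> 'a::{ring_1, topological_space} \<Rightarrow> 'a) \<Rightarrow> ('a point \<Rightarrow> 'a point) \<Rightarrow> system \<Rightarrow> system \<Rightarrow> bool" where
  "maps_system scl T S S' \<longleftrightarrow>
     (\<forall>\<Omega> u v \<kappa> \<Omega>' u' v' \<kappa>'.
        open \<Omega> \<and> \<Omega> \<subseteq> - {0, 1} \<and> T ` solution_graph \<Omega> u v \<kappa> = solution_graph \<Omega>' u' v' \<kappa>' \<longrightarrow>
        (solves scl S \<kappa> \<Omega> u v \<longleftrightarrow> solves scl S' \<kappa>' \<Omega>' u' v'))"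

text \<open>The transposition acts on points over the free algebra, so the whole group is realised there.\<close>

definition r_group :: "(complex \<Rightarrow> 'a::ring_1 \<Rightarrow> 'a) \<Rightarrow> ('a point \<Rightarrow> 'a point) monoid" where
  "r_group scl = subgroup_generated (BijGroup points) {r1 scl, r2 scl}"

definition full_group :: "(ncpoly point \<Rightarrow> ncpoly point) monoid" where
  "full_group = subgroup_generated (BijGroup points) {r1 nc_scale, r2 nc_scale, transposition}"

abbreviation swp :: "nat \<Rightarrow> nat \<Rightarrow> nat \<Rightarrow> nat" where
  "swp \<equiv> Transposition.transpose"

definition perm_r1 :: "nat \<Rightarrow> nat" where
  "perm_r1 = swp 1 3 \<circ> swp 13 14 \<circ> swp 4 6 \<circ> swp 16 18 \<circ>
     swp 7 8 \<circ> swp 9 12 \<circ> swp 10 11"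

definition perm_r2 :: "nat \<Rightarrow> nat" where
  "perm_r2 = swp 2 3 \<circ> swp 14 15 \<circ> swp 4 5 \<circ> swp 16 17 \<circ>
     swp 7 10 \<circ> swp 8 12 \<circ> swp 9 11"

definition perm_tau :: "nat \<Rightarrow> nat" where
  "perm_tau = swp 1 13 \<circ> swp 2 15 \<circ> swp 3 14 \<circ> swp 4 16 \<circ>
     swp 5 17 \<circ> swp 6 18 \<circ> swp 7 10 \<circ> swp 8 11 \<circ> swp 9 12"

end

theory Submission
  imports Defs
begin

text \<open>The correspondences between the systems are polynomial identities in the free algebra, checked
  monomial by monomial after the derivatives have been transformed by the chain and product rules.
  Since \<open>r\<^sub>1\<close> and \<open>r\<^sub>2\<close> are involutions that permute the systems by involutions, it is enough to
  transform solutions in one direction.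

  The group structure rests on the presentation of \<open>S\<^sub>3\<close> by two involutions \<open>a\<close>, \<open>b\<close> with
  \<open>b a b = a b a\<close>: such elements of any group give a homomorphism from \<open>S\<^sub>3\<close>, which is injective once
  \<open>1\<close>, \<open>a\<close>, \<open>b\<close> are distinct, and a further commuting involution \<open>t\<close> extends it to \<open>S\<^sub>3 \<times> \<int>\<^sub>2\<close>. Applied
  to the transformations this gives an isomorphism; applied to the permutations of the systems it
  gives a homomorphism, and composing the two gives the action.\<close>

section \<open>Homomorphisms out of the algebra of non-commutative polynomials\<close>

text \<open>Additive properties only need checking on monomials. The induction over
  \<open>update\<close> applies because setting a value at a key outside the support is the same as
  adding a monomial.\<close>

lemma poly_mapping_single_induct [case_names zero single add]:
  fixes f :: "'a \<Rightarrow>\<^sub>0 'b::monoid_add"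
  assumes "P 0" and "\<And>k c. P (Poly_Mapping.single k c)"
    and "\<And>f g. P f \<Longrightarrow> P g \<Longrightarrow> P (f + g)"
  shows "P f"
proof (induction f rule: update_induct)
  case (update f a b)
  have "Poly_Mapping.update a b f = f + Poly_Mapping.single a b"
    using update(1)
    by (intro poly_mapping_eqI)
      (auto simp: lookup_update lookup_add lookup_single when_def in_keys_iff)
  with update assms show ?case by simp
qed (rule assms)

section \<open>Reversal as an anti-automorphism\<close>

lemma inj_rev_word: "inj (\<lambda>w. Word (rev (letters w)))"
  by (auto intro!: injI simp: word.expand)

lemma nc_rev_single: "nc_rev (Poly_Mapping.single w c) = Poly_Mapping.single (Word (rev (letters w))) c"
  using map_key_single[OF inj_rev_word, of "Word (rev (letters w))"] by (simp add: nc_rev_def)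

lemma nc_rev_add: "nc_rev (f + g) = nc_rev f + nc_rev g"
  by (simp add: nc_rev_def map_key_plus[OF inj_rev_word])

lemma nc_rev_0 [simp]: "nc_rev 0 = 0"
  by (simp add: nc_rev_def inj_rev_word)

lemma nc_rev_uminus: "nc_rev (- f) = - nc_rev f"
  using nc_rev_add[of f "- f"] by (simp add: eq_neg_iff_add_eq_0 add.commute)

lemma nc_rev_diff: "nc_rev (f - g) = nc_rev f - nc_rev g"
  using nc_rev_add[of f "- g"] by (simp add: nc_rev_uminus)

lemma nc_rev_mult: "nc_rev (f * g) = nc_rev g * nc_rev f"
proof (induction f rule: poly_mapping_single_induct)
  case (single w c)
  show ?case
    by (induction g rule: poly_mapping_single_induct)
      (simp_all add: nc_rev_single nc_rev_add mult_single distrib_left distrib_right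
        plus_word_def mult.commute)
qed (simp_all add: nc_rev_add distrib_left distrib_right)

lemma nc_rev_nc_rev: "nc_rev (nc_rev f) = f"
  by (induction f rule: poly_mapping_single_induct) (simp_all add: nc_rev_single nc_rev_add)

lemma nc_rev_cst [simp]: "nc_rev (cst c) = cst c"
  by (simp add: cst_def nc_rev_single zero_word_def)

lemma nc_rev_var [simp]: "nc_rev (var l) = var l"
  by (simp add: var_def nc_rev_single)

lemma cst_1: "cst 1 = 1"
  by (simp add: cst_def)

lemma cst_numeral: "cst (numeral n) = numeral n"
  by (simp add: cst_def)

lemma nc_rev_1 [simp]: "nc_rev 1 = 1"
  using nc_rev_cst[of 1] by (simp add: cst_1)

lemma nc_rev_numeral [simp]: "nc_rev (numeral n) = numeral n"
  using nc_rev_cst[of "numeral n"] by (simp add: cst_numeral)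

text \<open>Scalars sit at the empty word, which reversal fixes, so they may stay on the left. This
  is what makes the transposition commute with \<open>r2\<close>.\<close>

lemma nc_rev_scale: "nc_rev (nc_scale c f) = nc_scale c (nc_rev f)"
  unfolding nc_scale_def
  by (induction f rule: poly_mapping_single_induct)
    (simp_all add: cst_def mult_single nc_rev_single nc_rev_add distrib_left plus_word_def zero_word_def)

lemma cst_commute: "f * cst c = cst c * f"
  by (induction f rule: poly_mapping_single_induct)
    (simp_all add: cst_def mult_single distrib_left distrib_right mult.commute)

lemma cst_left_commute: "f * (cst c * g) = cst c * (f * g)"
  by (metis cst_commute mult.assoc)

lemma vector_space_nc_scale: "vector_space nc_scale"
  by standard (simp_all add: nc_scale_def cst_def single_add distrib_left distrib_right
      mult_single flip: mult.assoc)

lemma complex_algebra_nc_scale: "complex_algebra nc_scale"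
  by (intro complex_algebra.intro complex_algebra_axioms.intro vector_space_nc_scale)
    (simp_all add: nc_scale_def mult.assoc cst_left_commute)

section \<open>Evaluation as an algebra homomorphism\<close>

context complex_algebra
begin

text \<open>Padding the support with zero coefficients lets two polynomials be summed over a common
  index set, whence additivity.\<close>

lemma nc_eval_superset:
  assumes "finite A" "Poly_Mapping.keys f \<subseteq> A"
  shows "nc_eval scl x y f = (\<Sum>w\<in>A. scl (Poly_Mapping.lookup f w)
    (prod_list (map (\<lambda>l. case l of U \<Rightarrow> x | V \<Rightarrow> y) (letters w))))"
  unfolding nc_eval_def using assms
  by (intro sum.mono_neutral_left) (auto simp: in_keys_iff)

lemma nc_eval_0 [simp]: "nc_eval scl x y 0 = 0"
  by (simp add: nc_eval_def)

lemma nc_eval_add: "nc_eval scl x y (f + g) = nc_eval scl x y f + nc_eval scl x y g"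
  using keys_add[of f g]
  by (simp add: nc_eval_superset[of "Poly_Mapping.keys f \<union> Poly_Mapping.keys g"] lookup_add
      scale_left_distrib sum.distrib)

lemma nc_eval_uminus: "nc_eval scl x y (- f) = - nc_eval scl x y f"
  using nc_eval_add[of x y f "- f"] by (simp add: eq_neg_iff_add_eq_0 add.commute)

lemma nc_eval_diff: "nc_eval scl x y (f - g) = nc_eval scl x y f - nc_eval scl x y g"
  using nc_eval_add[of x y f "- g"] by (simp add: nc_eval_uminus)

lemma nc_eval_single:
  "nc_eval scl x y (Poly_Mapping.single w c) =
     scl c (prod_list (map (\<lambda>l. case l of U \<Rightarrow> x | V \<Rightarrow> y) (letters w)))"
  by (simp add: nc_eval_superset[of "{w}"])

lemma nc_eval_mult: "nc_eval scl x y (f * g) = nc_eval scl x y f * nc_eval scl x y g"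
proof (induction f rule: poly_mapping_single_induct)
  case (single w c)
  show ?case
    by (induction g rule: poly_mapping_single_induct)
      (simp_all add: nc_eval_single nc_eval_add mult_single distrib_left distrib_right
        plus_word_def flip: scale_mult_left scale_mult_right)
qed (simp_all add: nc_eval_add distrib_left distrib_right)

lemma nc_eval_cst: "nc_eval scl x y (cst c) = scl c 1"
  by (simp add: cst_def nc_eval_single zero_word_def)

lemma nc_eval_var: "nc_eval scl x y (var l) = (case l of U \<Rightarrow> x | V \<Rightarrow> y)"
  by (simp add: var_def nc_eval_single)

lemma nc_eval_1: "nc_eval scl x y 1 = 1"
  using nc_eval_cst[of x y 1] by (simp add: cst_1)

lemma nc_eval_power: "nc_eval scl x y (f ^ n) = nc_eval scl x y f ^ n"
  by (induction n) (simp_all add: nc_eval_1 nc_eval_mult)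

lemma nc_eval_numeral: "nc_eval scl x y (numeral n) = numeral n"
proof (induction n)
  case (Bit0 n) then show ?case by (simp only: numeral.simps nc_eval_add)
next
  case (Bit1 n) then show ?case by (simp only: numeral.simps nc_eval_add nc_eval_1)
qed (simp add: nc_eval_1)

lemmas nc_eval_simps = nc_eval_add nc_eval_uminus nc_eval_diff nc_eval_mult nc_eval_cst
  nc_eval_var nc_eval_1 nc_eval_power nc_eval_numeral

end

text \<open>Rewriting with \<open>expand_products\<close>, then \<open>move_negatives\<close> turns both sides of an equation into
  sums of monomials without signs and coefficients; a polynomial identity then holds by
  associativity and commutativity of addition alone.\<close>

lemmas expand_products = distrib_left distrib_right left_diff_distrib right_diff_distrib mult.assoc
  mult_minus_left mult_minus_right mult_1_left mult_1_right

lemmas move_negatives = diff_0[symmetric] add_uminus_conv_diff uminus_add_conv_diff diff_minus_eq_add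
  minus_diff_eq diff_diff_eq diff_diff_eq2 add_diff_eq diff_add_eq diff_eq_eq eq_diff_eq
  add_0_left add_0_right

section \<open>The identities behind the transformations\<close>

lemma index_cases:
  assumes "m \<in> {1..18::nat}"
  shows "m = 1 \<or> m = 2 \<or> m = 3 \<or> m = 4 \<or> m = 5 \<or> m = 6 \<or> m = 7 \<or> m = 8 \<or> m = 9 \<or>
    m = 10 \<or> m = 11 \<or> m = 12 \<or> m = 13 \<or> m = 14 \<or> m = 15 \<or> m = 16 \<or> m = 17 \<or> m = 18"
  using assms unfolding atLeastAtMost_iff by presburger

context complex_algebra
begin

text \<open>Turns the scalar action into multiplication by the central element
  \<open>scl c 1\<close>, so that identities involving scalars become identities in the
  ring.\<close>

lemma scl_eq: "scl c x = scl c 1 * x"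
  by (simp flip: scale_mult_left)

lemma scl_1_mult: "scl (c * d) 1 = scl c 1 * scl d 1"
  by (simp flip: scale_mult_left)

lemma scl_1_commute: "x * scl c 1 = scl c 1 * x"
  by (simp flip: scale_mult_left scale_mult_right)

lemma scl_1_left_commute: "x * (scl c 1 * y) = scl c 1 * (x * y)"
  by (simp flip: scale_mult_left scale_mult_right)

lemma scl_1_numeral: "scl (numeral n) 1 = numeral n"
proof (induction n)
  case (Bit0 n) then show ?case by (simp only: numeral.simps scale_left_distrib)
next
  case (Bit1 n) then show ?case by (simp only: numeral.simps scale_left_distrib scale_one)
qed simp

lemma numeral_3_mult: "3 * r = r + r + r" "r * 3 = r + r + r" for r :: 'a
  by (simp_all only: numeral.simps distrib_left distrib_right mult_1_right mult_1_left add.assoc)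

lemma numeral_4_mult: "4 * r = r + r + r + r" "r * 4 = r + r + r + r" for r :: 'a
  by (simp_all only: numeral.simps distrib_left distrib_right mult_1_right mult_1_left add.assoc)

text \<open>Writing \<open>\<kappa>\<^sub>1 = 2a\<close> and \<open>\<kappa>\<^sub>3 = 2b\<close> clears the denominators in \<open>E\<^sub>1\<close> and \<open>E\<^sub>4\<close>.\<close>

lemma
  fixes a b k2 k4 z :: complex
  assumes "m \<in> {1..18}"
  defines "\<kappa> \<equiv> (2 * a, k2, 2 * b, k4)" and "\<kappa>' \<equiv> (2 * a, 2 * (2 * a) - k2 - k4, 2 * b, k4)"
  shows fst_P6_r1: "nc_eval scl (1 - x) (- y) (fst (P6 (perm_r1 m) \<kappa>' (1 - z))) =
      nc_eval scl x y (fst (P6 m \<kappa> z))"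
    and snd_P6_r1: "nc_eval scl (1 - x) (- y) (snd (P6 (perm_r1 m) \<kappa>' (1 - z))) =
      nc_eval scl x y (snd (P6 m \<kappa> z))"
proof -
  \<comment> \<open>A fixed normal form for monomials: scalars move left past the letters, and
    \<open>z\<close> moves left past the parameters. Instantiating the commutation rules this way
    keeps the rewriting from cycling.\<close>
  note central = scl_1_commute[of x] scl_1_commute[of y] scl_1_left_commute[of x] scl_1_left_commute[of y]
    scl_1_commute[of "scl a 1" z] scl_1_commute[of "scl b 1" z] scl_1_commute[of "scl k2 1" z]
    scl_1_commute[of "scl k4 1" z]
    scl_1_left_commute[of "scl a 1" z] scl_1_left_commute[of "scl b 1" z]
    scl_1_left_commute[of "scl k2 1" z] scl_1_left_commute[of "scl k4 1" z]
  have halves: "(2 * a + 2 * b) / 2 = a + b" "(6 * a - 2 * b) / 2 = 3 * a - b"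
    "((2 * b)\<^sup>2 - (2 * a)\<^sup>2) / 4 = b * b - a * a"
    by (simp_all add: field_simps power2_eq_square)
  note m = index_cases[OF assms(1)]
  show "nc_eval scl (1 - x) (- y) (fst (P6 (perm_r1 m) \<kappa>' (1 - z))) =
      nc_eval scl x y (fst (P6 m \<kappa> z))"
    using m
    by (elim disjE;
        simp add: \<kappa>_def \<kappa>'_def perm_r1_def Transposition.transpose_def
          P6_def pqrs_table_def Let_def nc_eval_simps halves;
        simp only: scale_left_distrib scale_left_diff_distrib scale_minus_left scl_1_mult
          scl_1_numeral power2_eq_square power3_eq_cube scale_one;
        simp only: expand_products mult_2 mult_2_right numeral_3_mult numeral_4_mult central;
        simp only: move_negatives;
        simp only: add_ac)
  show "nc_eval scl (1 - x) (- y) (snd (P6 (perm_r1 m) \<kappa>' (1 - z))) =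
      nc_eval scl x y (snd (P6 m \<kappa> z))"
    using m
    by (elim disjE;
        simp add: \<kappa>_def \<kappa>'_def perm_r1_def Transposition.transpose_def
          P6_def pqrs_table_def Let_def nc_eval_simps halves;
        simp only: scale_left_distrib scale_left_diff_distrib scale_minus_left scl_1_mult
          scl_1_numeral power2_eq_square power3_eq_cube scale_one;
        simp only: expand_products mult_2 mult_2_right numeral_3_mult numeral_4_mult central;
        simp only: move_negatives;
        simp only: add_ac)
qed

text \<open>With \<open>w = 1/z\<close>, the derivative of \<open>w u(1/w)\<close> is
  \<open>u - z u'\<close> and that of \<open>v(1/w) / w\<close> is \<open>- z^2 (v + z v')\<close>.
  Multiplying by \<open>w (w - 1) = (1 - z) / z^2\<close> produces the factor \<open>1/z^2\<close>
  and the extra terms in \<open>x\<close> and \<open>y\<close>.\<close>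

lemma
  fixes a b k2 k4 z :: complex
  assumes "m \<in> {1..18}" and "z \<noteq> 0"
  defines "\<kappa> \<equiv> (2 * a, k2, 2 * b, k4)" and "\<kappa>' \<equiv> (2 * a, k4 - 1, 2 * b, k2 + 1)"
  shows fst_P6_r2: "nc_eval scl (scl (inverse z) x) (scl z y) (fst (P6 (perm_r2 m) \<kappa>' (inverse z))) =
      scl (inverse z * inverse z) (nc_eval scl x y (fst (P6 m \<kappa> z)) + scl (1 - z) x)"
    and snd_P6_r2: "nc_eval scl (scl (inverse z) x) (scl z y) (snd (P6 (perm_r2 m) \<kappa>' (inverse z))) =
      nc_eval scl x y (snd (P6 m \<kappa> z)) + scl (z - 1) y"
proof -
  \<comment> \<open>The inverse is treated as a further scalar symbol whose only relation to
    \<open>z\<close> is cancellation, so that both sides remain polynomial.\<close>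
  define i where "i = inverse z"
  have zi: "scl z 1 * scl i 1 = 1" "scl i 1 * scl z 1 = 1"
    using \<open>z \<noteq> 0\<close> by (simp_all add: i_def flip: scl_1_mult)
  have zi': "scl z 1 * (scl i 1 * r) = r" "scl i 1 * (scl z 1 * r) = r" for r
    using zi by (simp_all flip: mult.assoc)
  note central = zi zi' scl_1_commute[of x] scl_1_commute[of y] scl_1_left_commute[of x] scl_1_left_commute[of y]
    scl_1_commute[of "scl a 1" z] scl_1_commute[of "scl b 1" z] scl_1_commute[of "scl k2 1" z]
    scl_1_commute[of "scl k4 1" z]
    scl_1_left_commute[of "scl a 1" z] scl_1_left_commute[of "scl b 1" z]
    scl_1_left_commute[of "scl k2 1" z] scl_1_left_commute[of "scl k4 1" z]
    scl_1_commute[of "scl a 1" i] scl_1_commute[of "scl b 1" i] scl_1_commute[of "scl k2 1" i]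
    scl_1_commute[of "scl k4 1" i]
    scl_1_left_commute[of "scl a 1" i] scl_1_left_commute[of "scl b 1" i]
    scl_1_left_commute[of "scl k2 1" i] scl_1_left_commute[of "scl k4 1" i]
  have halves: "(2 * a + 2 * b) / 2 = a + b" "(6 * a - 2 * b) / 2 = 3 * a - b"
    "((2 * b)\<^sup>2 - (2 * a)\<^sup>2) / 4 = b * b - a * a"
    by (simp_all add: field_simps power2_eq_square)
  note m = index_cases[OF assms(1)]
  \<comment> \<open>\<open>scl_eq\<close> would apply to its own right-hand side at
    \<open>1\<close>, so only the instances that occur are rewritten.\<close>
  have sx: "scl i x = scl i 1 * x" "scl z y = scl z 1 * y" "scl (1 - z) x = scl (1 - z) 1 * x"
    "scl (z - 1) y = scl (z - 1) 1 * y" and si: "scl (i * i) r = scl i 1 * (scl i 1 * r)" for r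
    by (simp_all add: scl_eq[of _ x] scl_eq[of _ y] scl_eq[of _ r] scl_1_mult mult.assoc)
  show "nc_eval scl (scl (inverse z) x) (scl z y) (fst (P6 (perm_r2 m) \<kappa>' (inverse z))) =
      scl (inverse z * inverse z) (nc_eval scl x y (fst (P6 m \<kappa> z)) + scl (1 - z) x)"
    unfolding i_def[symmetric] sx si
    using m
    by (elim disjE;
        simp add: \<kappa>_def \<kappa>'_def perm_r2_def Transposition.transpose_def
          P6_def pqrs_table_def Let_def nc_eval_simps halves;
        simp only: scale_left_distrib scale_left_diff_distrib scale_minus_left scl_1_mult
          scl_1_numeral power2_eq_square power3_eq_cube scale_one;
        simp only: expand_products mult_2 mult_2_right numeral_3_mult numeral_4_mult central;
        simp only: move_negatives;
        simp only: add_ac)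
  show "nc_eval scl (scl (inverse z) x) (scl z y) (snd (P6 (perm_r2 m) \<kappa>' (inverse z))) =
      nc_eval scl x y (snd (P6 m \<kappa> z)) + scl (z - 1) y"
    unfolding i_def[symmetric] sx si
    using m
    by (elim disjE;
        simp add: \<kappa>_def \<kappa>'_def perm_r2_def Transposition.transpose_def
          P6_def pqrs_table_def Let_def nc_eval_simps halves;
        simp only: scale_left_distrib scale_left_diff_distrib scale_minus_left scl_1_mult
          scl_1_numeral power2_eq_square power3_eq_cube scale_one;
        simp only: expand_products mult_2 mult_2_right numeral_3_mult numeral_4_mult central;
        simp only: move_negatives;
        simp only: add_ac)
qed

end

section \<open>Transformation of solutions\<close>

context topological_complex_algebra
begin

lemma tendsto_scale:
  assumes "(f \<longlongrightarrow> c) F" "(g \<longlongrightarrow> x) F"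
  shows "((\<lambda>w. scl (f w) (g w)) \<longlongrightarrow> scl c x) F"
proof -
  have "isCont (\<lambda>(c, x). scl c x) (c, x)"
    using continuous_scale by (simp add: continuous_on_eq_continuous_at)
  from isCont_tendsto_compose[OF this tendsto_Pair[OF assms]] show ?thesis by simp
qed

lemma has_complex_deriv_transform:
  assumes "has_complex_deriv scl g D z" "open \<Omega>" "z \<in> \<Omega>" "\<And>w. w \<in> \<Omega> \<Longrightarrow> f w = g w"
  shows "has_complex_deriv scl f D z"
proof -
  have "eventually (\<lambda>w. scl (inverse (w - z)) (g w - g z) = scl (inverse (w - z)) (f w - f z)) (at z)"
    using eventually_at_in_open'[OF assms(2,3)] by eventually_elim (simp add: assms)
  with assms(1) show ?thesis
    unfolding has_complex_deriv_def by (rule Lim_transform_eventually)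
qed

lemma has_complex_deriv_const_diff:
  assumes "has_complex_deriv scl f D z"
  shows "has_complex_deriv scl (\<lambda>w. c - f w) (- D) z"
proof -
  have "scl (inverse (w - z)) (c - f w - (c - f z)) = - scl (inverse (w - z)) (f w - f z)" for w
    by (simp flip: scale_minus_right)
  then show ?thesis
    using tendsto_minus assms unfolding has_complex_deriv_def by auto
qed

text \<open>The quotient factors through the difference quotient of \<open>f\<close> at
  \<open>g z\<close>, a punctured limit. Hence \<open>g w\<close> must avoid \<open>g z\<close> near
  \<open>z\<close>, which injective maps such as \<open>1 - z\<close> and \<open>1/z\<close>
  do.\<close>

lemma has_complex_deriv_compose:
  assumes f: "has_complex_deriv scl f D (g z)" and g: "(g has_field_derivative g') (at z)"
    and inj: "eventually (\<lambda>w. g w \<noteq> g z) (at z)"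
  shows "has_complex_deriv scl (\<lambda>w. f (g w)) (scl g' D) z"
proof -
  have "filterlim g (at (g z)) (at z)"
    using DERIV_isCont[OF g] inj by (auto simp: filterlim_at isCont_def elim: eventually_mono)
  from filterlim_compose[OF f[unfolded has_complex_deriv_def] this]
  have "((\<lambda>w. scl ((g w - g z) / (w - z)) (scl (inverse (g w - g z)) (f (g w) - f (g z)))) \<longlongrightarrow>
      scl g' D) (at z)"
    using g by (intro tendsto_scale) (auto simp: has_field_derivative_iff)
  moreover have "eventually (\<lambda>w. scl ((g w - g z) / (w - z)) (scl (inverse (g w - g z)) (f (g w) - f (g z)))
      = scl (inverse (w - z)) (f (g w) - f (g z))) (at z)"
    using inj by eventually_elim (simp add: divide_inverse)
  ultimately show ?thesis
    unfolding has_complex_deriv_def by (rule Lim_transform_eventually)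
qed

text \<open>The product rule for a scalar function times an algebra-valued one. Only the scalar
  action occurs, so its joint continuity suffices without continuity of the algebra
  multiplication.\<close>

lemma has_complex_deriv_scale:
  assumes f: "has_complex_deriv scl f D z" and g: "(g has_field_derivative g') (at z)"
  shows "has_complex_deriv scl (\<lambda>w. scl (g w) (f w)) (scl (g z) D + scl g' (f z)) z"
proof -
  have "((\<lambda>w. scl (g w) (scl (inverse (w - z)) (f w - f z)) + scl ((g w - g z) / (w - z)) (f z)) \<longlongrightarrow>
      scl (g z) D + scl g' (f z)) (at z)"
    using f g DERIV_isCont[OF g]
    by (intro tendsto_add tendsto_scale) (auto simp: has_complex_deriv_def has_field_derivative_iff isCont_def)
  moreover have "scl (g w) (scl (inverse (w - z)) (f w - f z)) + scl ((g w - g z) / (w - z)) (f z) =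
      scl (inverse (w - z)) (scl (g w) (f w) - scl (g z) (f z))" for w
  proof -
    have "scl (g w) (scl (inverse (w - z)) (f w - f z)) + scl ((g w - g z) / (w - z)) (f z) =
        scl (inverse (w - z)) (scl (g w) (f w - f z) + scl (g w - g z) (f z))"
      by (simp add: divide_inverse mult.commute scale_right_distrib)
    also have "scl (g w) (f w - f z) + scl (g w - g z) (f z) = scl (g w) (f w) - scl (g z) (f z)"
      by (simp add: scale_right_diff_distrib scale_left_diff_distrib)
    finally show ?thesis .
  qed
  ultimately show ?thesis
    by (simp add: has_complex_deriv_def)
qed

end

text \<open>Both implications in \<open>maps_system\<close> come from \<open>step\<close>: once for
  the given graph and once for its image, which \<open>T\<close> sends back. \<open>R\<close> holds
  all pairs for which \<open>step\<close> is available, including the reversed one. The second use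
  requires \<open>\<Omega>'\<close> to be open, and this is where the map \<open>t\<close> on the
  variable enters.\<close>

lemma maps_system_involution:
  assumes T: "\<And>p. p \<in> points \<Longrightarrow> T (T p) = p \<and> fst (T p) = t (fst p)"
    and t: "continuous_on (- {0, 1}) t" "\<And>z. z \<in> - {0, 1} \<Longrightarrow> t z \<in> - {0, 1} \<and> t (t z) = z"
    and step: "\<And>S S' \<Omega> u v \<kappa> \<Omega>' u' v' \<kappa>'. (S, S') \<in> R \<Longrightarrow> open \<Omega> \<Longrightarrow> \<Omega> \<subseteq> - {0, 1} \<Longrightarrow> open \<Omega>' \<Longrightarrow>
      T ` solution_graph \<Omega> u v \<kappa> = solution_graph \<Omega>' u' v' \<kappa>' \<Longrightarrow>
      solves scl S \<kappa> \<Omega> u v \<Longrightarrow> solves scl S' \<kappa>' \<Omega>' u' v'"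
    and R: "(S, S') \<in> R" "(S', S) \<in> R"
  shows "maps_system scl T S S'"
  unfolding maps_system_def
proof (intro allI impI, elim conjE)
  fix \<Omega> u v \<kappa> \<Omega>' u' v' \<kappa>'
  assume \<Omega>: "open \<Omega>" "\<Omega> \<subseteq> - {0, 1}"
    and graph: "T ` solution_graph \<Omega> u v \<kappa> = solution_graph \<Omega>' u' v' \<kappa>'"
  have sub: "solution_graph \<Omega> u v \<kappa> \<subseteq> points"
    using \<Omega> by (auto simp: solution_graph_def points_def)
  have fst_graph: "fst ` solution_graph A f g l = A" for A and f g :: "complex \<Rightarrow> 'a" and l
    by (simp add: solution_graph_def image_image)
  have "fst ` T ` solution_graph \<Omega> u v \<kappa> = t ` fst ` solution_graph \<Omega> u v \<kappa>"
    unfolding image_image using T sub by (intro image_cong) auto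
  then have "\<Omega>' = t ` \<Omega>"
    by (simp only: graph fst_graph)
  \<comment> \<open>The image under an involution is a preimage, so continuity of \<open>t\<close>
    gives openness.\<close>
  moreover have "t ` \<Omega> = t -` \<Omega> \<inter> - {0, 1}"
  proof (intro equalityI subsetI)
    fix w assume "w \<in> t ` \<Omega>"
    then show "w \<in> t -` \<Omega> \<inter> - {0, 1}"
      using \<Omega>(2) t(2) by (metis IntI image_iff subsetD vimageI)
  next
    fix w assume "w \<in> t -` \<Omega> \<inter> - {0, 1}"
    then show "w \<in> t ` \<Omega>"
      using t(2) by (metis IntE image_eqI vimageE)
  qed
  ultimately have "\<Omega>' = t -` \<Omega> \<inter> - {0, 1}"
    by (rule trans)
  then have \<Omega>': "open \<Omega>'" "\<Omega>' \<subseteq> - {0, 1}"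
    using iffD1[OF continuous_on_open_vimage, of "- {0, 1}" t] t(1) \<Omega>(1)
    by (simp_all add: open_Compl)
  have "T ` solution_graph \<Omega>' u' v' \<kappa>' = solution_graph \<Omega> u v \<kappa>"
  proof -
    have "(\<lambda>p. T (T p)) ` solution_graph \<Omega> u v \<kappa> = (\<lambda>p. p) ` solution_graph \<Omega> u v \<kappa>"
      using T sub by (intro image_cong refl) blast
    then show ?thesis
      by (simp add: image_image flip: graph)
  qed
  then show "solves scl S \<kappa> \<Omega> u v \<longleftrightarrow> solves scl S' \<kappa>' \<Omega>' u' v'"
    using step[OF R(1) \<Omega> \<Omega>'(1) graph] step[OF R(2) \<Omega>' \<Omega>(1)] by blast
qed

text \<open>The involution, braid and commutation relations of \<open>S_3 x Z_2\<close> for the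
  index permutations, verified at each of the 18 indices.\<close>

lemma perm_relations:
  assumes "m \<in> {1..18}"
  shows "perm_r1 m \<in> {1..18}" "perm_r2 m \<in> {1..18}" "perm_tau m \<in> {1..18}"
    "perm_r1 (perm_r1 m) = m" "perm_r2 (perm_r2 m) = m" "perm_tau (perm_tau m) = m"
    "perm_r2 (perm_r1 (perm_r2 m)) = perm_r1 (perm_r2 (perm_r1 m))"
    "perm_tau (perm_r1 m) = perm_r1 (perm_tau m)" "perm_tau (perm_r2 m) = perm_r2 (perm_tau m)"
  using index_cases[OF assms]
  by (elim disjE; simp add: perm_r1_def perm_r2_def perm_tau_def Transposition.transpose_def)+

section \<open>The transformations r1 and r2 on points and on solutions\<close>

lemma r1_simps:
  "z \<noteq> 0 \<Longrightarrow> z \<noteq> 1 \<Longrightarrow> r1 scl (z, u, v, \<kappa>1, \<kappa>2, \<kappa>3, \<kappa>4) =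
     (1 - z, 1 - u, - v, \<kappa>1, 2 * \<kappa>1 - \<kappa>2 - \<kappa>4, \<kappa>3, \<kappa>4)"
  by (simp add: r1_def points_def)

lemma r2_simps:
  "z \<noteq> 0 \<Longrightarrow> z \<noteq> 1 \<Longrightarrow> r2 scl (z, u, v, \<kappa>1, \<kappa>2, \<kappa>3, \<kappa>4) =
     (inverse z, scl (inverse z) u, scl z v, \<kappa>1, \<kappa>4 - 1, \<kappa>3, \<kappa>2 + 1)"
  by (simp add: r2_def points_def)

lemma points_cases:
  assumes "p \<in> points"
  obtains z u v \<kappa>1 \<kappa>2 \<kappa>3 \<kappa>4 where "p = (z, u, v, \<kappa>1, \<kappa>2, \<kappa>3, \<kappa>4)" "z \<noteq> 0" "z \<noteq> 1"
  using assms by (auto simp: points_def)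

lemma r1_involution:
  assumes "p \<in> points"
  shows "r1 scl p \<in> points" "r1 scl (r1 scl p) = p" "fst (r1 scl p) = 1 - fst p"
  using assms by (auto elim!: points_cases simp: r1_simps points_def)

lemma (in complex_algebra) r2_involution:
  assumes "p \<in> points"
  shows "r2 scl p \<in> points" "r2 scl (r2 scl p) = p" "fst (r2 scl p) = inverse (fst p)"
  using assms by (auto elim!: points_cases simp: r2_simps points_def)

context topological_complex_algebra
begin

text \<open>The sign from the chain rule for \<open>1 - z\<close> cancels the sign in
  \<open>1 - u\<close> and \<open>- v\<close>, and \<open>z (z - 1)\<close> is invariant under the
  reflection. The left-hand sides are therefore unchanged, and the polynomial identities settle the
  right-hand sides.\<close>

lemma solves_r1:
  assumes m: "m \<in> {1..18}" and \<Omega>: "open \<Omega>" "\<Omega> \<subseteq> - {0, 1}" and \<Omega>': "open \<Omega>'"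
    and graph: "r1 scl ` solution_graph \<Omega> u v \<kappa> = solution_graph \<Omega>' u' v' \<kappa>'"
    and sol: "solves scl (P6 m) \<kappa> \<Omega> u v"
  shows "solves scl (P6 (perm_r1 m)) \<kappa>' \<Omega>' u' v'"
  unfolding solves_def
proof
  obtain \<kappa>1 \<kappa>2 \<kappa>3 \<kappa>4 where \<kappa>: "\<kappa> = (\<kappa>1, \<kappa>2, \<kappa>3, \<kappa>4)"
    by (cases \<kappa>)
  \<comment> \<open>The negation is written as a difference from 0 so that \<open>reflect\<close>
    covers both components, with \<open>c = 1\<close> and \<open>c = 0\<close>. The parameters
    \<open>\<kappa>'\<close> are read off at a point of \<open>\<Omega>'\<close>; over an empty
    domain there is nothing to show.\<close>
  have at: "1 - w \<in> \<Omega> \<and> u' w = 1 - u (1 - w) \<and> v' w = 0 - v (1 - w) \<and>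
      \<kappa>' = (\<kappa>1, 2 * \<kappa>1 - \<kappa>2 - \<kappa>4, \<kappa>3, \<kappa>4)" if "w \<in> \<Omega>'" for w
  proof -
    have "(w, u' w, v' w, \<kappa>') \<in> r1 scl ` solution_graph \<Omega> u v \<kappa>"
      unfolding graph using that by (simp add: solution_graph_def)
    then obtain z where z: "z \<in> \<Omega>" and *: "(w, u' w, v' w, \<kappa>') = r1 scl (z, u z, v z, \<kappa>)"
      by (auto simp: solution_graph_def)
    then have "z \<noteq> 0" "z \<noteq> 1"
      using \<Omega> by auto
    from * have "w = 1 - z \<and> u' w = 1 - u z \<and> v' w = - v z \<and> \<kappa>' = (\<kappa>1, 2 * \<kappa>1 - \<kappa>2 - \<kappa>4, \<kappa>3, \<kappa>4)"
      unfolding \<kappa> r1_simps[OF \<open>z \<noteq> 0\<close> \<open>z \<noteq> 1\<close>] prod.inject .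
    then have w: "w = 1 - z" and eqs: "u' w = 1 - u z" "v' w = - v z" "\<kappa>' = (\<kappa>1, 2 * \<kappa>1 - \<kappa>2 - \<kappa>4, \<kappa>3, \<kappa>4)"
      by blast+
    from w have "1 - w = z" by simp
    with z eqs \<open>z \<noteq> 0\<close> show ?thesis by simp
  qed
  fix w assume w: "w \<in> \<Omega>'"
  with at have z: "1 - w \<in> \<Omega>" by simp
  from sol z obtain D E where
    D: "has_complex_deriv scl u D (1 - w)" "has_complex_deriv scl v E (1 - w)" and
    eqs: "scl ((1 - w) * (1 - w - 1)) D = nc_eval scl (u (1 - w)) (v (1 - w)) (fst (P6 m \<kappa> (1 - w)))"
      "scl ((1 - w) * (1 - w - 1)) E = nc_eval scl (u (1 - w)) (v (1 - w)) (snd (P6 m \<kappa> (1 - w)))"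
    unfolding solves_def by meson
  \<comment> \<open>The polynomial identities are stated for parameters \<open>2 * a\<close> and
    \<open>2 * b\<close>, so the first and third parameters are rewritten as doubles of their
    halves.\<close>
  have half: "2 * (c / 2) = c" for c :: complex
    by simp
  have reflect: "has_complex_deriv scl (\<lambda>w. c - f (1 - w)) F w"
    if "has_complex_deriv scl f F (1 - w)" for c f F
  proof -
    have deriv: "((\<lambda>w. 1 - w) has_field_derivative -1) (at w)"
      by (auto intro!: derivative_eq_intros)
    have "eventually (\<lambda>x. 1 - x \<noteq> 1 - w) (at w)"
      by (auto simp: eventually_at_filter)
    from has_complex_deriv_const_diff[OF has_complex_deriv_compose[where g = "\<lambda>w. 1 - w", OF that deriv this]]
    show ?thesis by simp
  qed
  have "has_complex_deriv scl u' D w" "has_complex_deriv scl v' E w"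
    using at by (auto intro: has_complex_deriv_transform[OF reflect[OF D(1)] \<Omega>' w]
        has_complex_deriv_transform[OF reflect[OF D(2)] \<Omega>' w])
  moreover have "scl (w * (w - 1)) D = nc_eval scl (u' w) (v' w) (fst (P6 (perm_r1 m) \<kappa>' w))"
  proof -
    have "nc_eval scl (u' w) (v' w) (fst (P6 (perm_r1 m) \<kappa>' w)) =
        nc_eval scl (1 - u (1 - w)) (- v (1 - w)) (fst (P6 (perm_r1 m)
          (2 * (\<kappa>1 / 2), 2 * (2 * (\<kappa>1 / 2)) - \<kappa>2 - \<kappa>4, 2 * (\<kappa>3 / 2), \<kappa>4) (1 - (1 - w))))"
      using at[OF w] by simp
    also have "\<dots> = scl ((1 - w) * (1 - w - 1)) D"
      unfolding fst_P6_r1[OF m] by (simp only: eqs(1) \<kappa> half)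
    also have "(1 - w) * (1 - w - 1) = w * (w - 1)"
      by (simp add: algebra_simps)
    finally show ?thesis by simp
  qed
  moreover have "scl (w * (w - 1)) E = nc_eval scl (u' w) (v' w) (snd (P6 (perm_r1 m) \<kappa>' w))"
  proof -
    have "nc_eval scl (u' w) (v' w) (snd (P6 (perm_r1 m) \<kappa>' w)) =
        nc_eval scl (1 - u (1 - w)) (- v (1 - w)) (snd (P6 (perm_r1 m)
          (2 * (\<kappa>1 / 2), 2 * (2 * (\<kappa>1 / 2)) - \<kappa>2 - \<kappa>4, 2 * (\<kappa>3 / 2), \<kappa>4) (1 - (1 - w))))"
      using at[OF w] by simp
    also have "\<dots> = scl ((1 - w) * (1 - w - 1)) E"
      unfolding snd_P6_r1[OF m] by (simp only: eqs(2) \<kappa> half)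
    also have "(1 - w) * (1 - w - 1) = w * (w - 1)"
      by (simp add: algebra_simps)
    finally show ?thesis by simp
  qed
  ultimately show "\<exists>D E. has_complex_deriv scl u' D w \<and> has_complex_deriv scl v' E w \<and>
      scl (w * (w - 1)) D = nc_eval scl (u' w) (v' w) (fst (P6 (perm_r1 m) \<kappa>' w)) \<and>
      scl (w * (w - 1)) E = nc_eval scl (u' w) (v' w) (snd (P6 (perm_r1 m) \<kappa>' w))"
    by blast
qed

lemma solves_r2:
  assumes m: "m \<in> {1..18}" and \<Omega>: "open \<Omega>" "\<Omega> \<subseteq> - {0, 1}" and \<Omega>': "open \<Omega>'"
    and graph: "r2 scl ` solution_graph \<Omega> u v \<kappa> = solution_graph \<Omega>' u' v' \<kappa>'"
    and sol: "solves scl (P6 m) \<kappa> \<Omega> u v"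
  shows "solves scl (P6 (perm_r2 m)) \<kappa>' \<Omega>' u' v'"
  unfolding solves_def
proof
  obtain \<kappa>1 \<kappa>2 \<kappa>3 \<kappa>4 where \<kappa>: "\<kappa> = (\<kappa>1, \<kappa>2, \<kappa>3, \<kappa>4)"
    by (cases \<kappa>)
  have at: "inverse w \<in> \<Omega> \<and> w \<noteq> 0 \<and> u' w = scl w (u (inverse w)) \<and>
      v' w = scl (inverse w) (v (inverse w)) \<and> \<kappa>' = (\<kappa>1, \<kappa>4 - 1, \<kappa>3, \<kappa>2 + 1)" if "w \<in> \<Omega>'" for w
  proof -
    have "(w, u' w, v' w, \<kappa>') \<in> r2 scl ` solution_graph \<Omega> u v \<kappa>"
      unfolding graph using that by (simp add: solution_graph_def)
    then obtain z where z: "z \<in> \<Omega>" and *: "(w, u' w, v' w, \<kappa>') = r2 scl (z, u z, v z, \<kappa>)"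
      by (auto simp: solution_graph_def)
    then have "z \<noteq> 0" "z \<noteq> 1"
      using \<Omega> by auto
    from * have "w = inverse z \<and> u' w = scl (inverse z) (u z) \<and> v' w = scl z (v z) \<and> \<kappa>' = (\<kappa>1, \<kappa>4 - 1, \<kappa>3, \<kappa>2 + 1)"
      unfolding \<kappa> r2_simps[OF \<open>z \<noteq> 0\<close> \<open>z \<noteq> 1\<close>] prod.inject .
    then have w: "w = inverse z" and eqs: "u' w = scl (inverse z) (u z)" "v' w = scl z (v z)" "\<kappa>' = (\<kappa>1, \<kappa>4 - 1, \<kappa>3, \<kappa>2 + 1)"
      by blast+
    from w have "inverse w = z" "inverse z = w" "w = 0 \<longleftrightarrow> z = 0" by simp_all
    with z eqs \<open>z \<noteq> 0\<close> show ?thesis by simp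
  qed
  fix w assume w: "w \<in> \<Omega>'"
  define z where "z = inverse w"
  with at[OF w] have z: "z \<in> \<Omega>" "z \<noteq> 0" "w \<noteq> 0" "inverse z = w"
    and \<kappa>': "\<kappa>' = (\<kappa>1, \<kappa>4 - 1, \<kappa>3, \<kappa>2 + 1)" by auto
  from sol z obtain D E where
    D: "has_complex_deriv scl u D z" "has_complex_deriv scl v E z" and
    eqs: "scl (z * (z - 1)) D = nc_eval scl (u z) (v z) (fst (P6 m \<kappa> z))"
      "scl (z * (z - 1)) E = nc_eval scl (u z) (v z) (snd (P6 m \<kappa> z))"
    unfolding solves_def by meson
  have invert: "has_complex_deriv scl (\<lambda>w. f (inverse w)) (scl (- (z * z)) F) w"
    if "has_complex_deriv scl f F z" for f F
  proof (rule has_complex_deriv_compose[where g = inverse])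
    show "has_complex_deriv scl f F (inverse w)" using that by (simp add: z_def)
    show "(inverse has_field_derivative - (z * z)) (at w)"
      using DERIV_inverse[OF \<open>w \<noteq> 0\<close>] by (simp add: z_def power2_eq_square)
    show "eventually (\<lambda>x. inverse x \<noteq> inverse w) (at w)"
      by (auto simp: eventually_at_filter)
  qed
  have uv: "u' w = scl w (u z)" "v' w = scl z (v z)"
    using at[OF w] by (simp_all add: z_def)
  \<comment> \<open>The product rule at \<open>w = 1/z\<close>. Inversion has derivative
    \<open>- z^2\<close> there; it enters through the chain rule in both components and, in the
    second, also as the derivative of the outer factor.\<close>
  let ?D = "scl w (scl (- (z * z)) D) + scl 1 (u z)"
  let ?E = "scl z (scl (- (z * z)) E) + scl (- (z * z)) (v z)"
  have "has_complex_deriv scl (\<lambda>w. scl w (u (inverse w))) ?D w"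
    using has_complex_deriv_scale[OF invert[OF D(1)] DERIV_ident] by (simp add: z_def)
  moreover have "has_complex_deriv scl (\<lambda>w. scl (inverse w) (v (inverse w))) ?E w"
    using has_complex_deriv_scale[OF invert[OF D(2)] DERIV_inverse[OF \<open>w \<noteq> 0\<close>]]
    by (simp add: z_def power2_eq_square)
  ultimately have "has_complex_deriv scl u' ?D w" "has_complex_deriv scl v' ?E w"
    using at by (auto intro: has_complex_deriv_transform[OF _ \<Omega>' w])
  moreover have "scl (w * (w - 1)) ?D = nc_eval scl (u' w) (v' w) (fst (P6 (perm_r2 m) \<kappa>' w))"
  proof -
    have "nc_eval scl (u' w) (v' w) (fst (P6 (perm_r2 m) \<kappa>' w)) =
        scl (w * w) (scl (z * (z - 1)) D + scl (1 - z) (u z))"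
      using fst_P6_r2[OF m \<open>z \<noteq> 0\<close>, where a = "\<kappa>1 / 2" and b = "\<kappa>3 / 2"]
      by (simp add: eqs(1) uv \<kappa> \<kappa>' z(4))
    \<comment> \<open>Since \<open>w * z = 1\<close>, comparing the coefficients of \<open>D\<close>
      and of \<open>u z\<close> leaves two identities between scalars.\<close>
    also have "\<dots> = scl (w * w * (z * (z - 1))) D + scl (w * w * (1 - z)) (u z)"
      by (simp add: scale_right_distrib)
    also have "w * w * (z * (z - 1)) = w * (w - 1) * (w * - (z * z))"
      using z by (simp add: field_simps z_def)
    also have "w * w * (1 - z) = w * (w - 1)"
      using z by (simp add: field_simps z_def)
    finally show ?thesis
      by (simp add: scale_right_distrib scale_right_diff_distrib)
  qed
  moreover have "scl (w * (w - 1)) ?E = nc_eval scl (u' w) (v' w) (snd (P6 (perm_r2 m) \<kappa>' w))"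
  proof -
    have "nc_eval scl (u' w) (v' w) (snd (P6 (perm_r2 m) \<kappa>' w)) =
        scl (z * (z - 1)) E + scl (z - 1) (v z)"
      using snd_P6_r2[OF m \<open>z \<noteq> 0\<close>, where a = "\<kappa>1 / 2" and b = "\<kappa>3 / 2"]
      by (simp add: eqs(2) uv \<kappa> \<kappa>' z(4))
    also have "z * (z - 1) = w * (w - 1) * (z * - (z * z))"
      using z by (simp add: field_simps z_def)
    also have "z - 1 = w * (w - 1) * - (z * z)"
      using z by (simp add: field_simps z_def)
    finally show ?thesis
      by (simp add: scale_right_distrib scale_right_diff_distrib)
  qed
  ultimately show "\<exists>D E. has_complex_deriv scl u' D w \<and> has_complex_deriv scl v' E w \<and>
      scl (w * (w - 1)) D = nc_eval scl (u' w) (v' w) (fst (P6 (perm_r2 m) \<kappa>' w)) \<and>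
      scl (w * (w - 1)) E = nc_eval scl (u' w) (v' w) (snd (P6 (perm_r2 m) \<kappa>' w))"
    by blast
qed

lemma maps_system_r1:
  assumes "m \<in> {1..18}"
  shows "maps_system scl (r1 scl) (P6 m) (P6 (perm_r1 m))"
\<comment> \<open>The relation is the graph of the permutation on systems; it contains the reversed
  pair because \<open>perm_r1\<close> is an involution.\<close>
proof (rule maps_system_involution[where t = "\<lambda>z. 1 - z" and R = "{(P6 n, P6 (perm_r1 n)) |n. n \<in> {1..18}}"])
  show "(P6 (perm_r1 m), P6 m) \<in> {(P6 n, P6 (perm_r1 n)) |n. n \<in> {1..18}}"
    using perm_relations[OF assms] by force
qed (use assms in \<open>auto simp del: atLeastAtMost_iff One_nat_def simp: r1_involution intro: continuous_intros solves_r1\<close>)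

lemma maps_system_r2:
  assumes "m \<in> {1..18}"
  shows "maps_system scl (r2 scl) (P6 m) (P6 (perm_r2 m))"
proof (rule maps_system_involution[where t = inverse and R = "{(P6 n, P6 (perm_r2 n)) |n. n \<in> {1..18}}"])
  show "(P6 (perm_r2 m), P6 m) \<in> {(P6 n, P6 (perm_r2 n)) |n. n \<in> {1..18}}"
    using perm_relations[OF assms] by force
qed (use assms in \<open>auto simp del: atLeastAtMost_iff One_nat_def simp: r2_involution intro!: continuous_intros intro: solves_r2\<close>)

end

section \<open>Groups generated by involutions with the relations of \<open>S\<^sub>3\<close> and \<open>S\<^sub>3 \<times> \<int>\<^sub>2\<close>\<close>

text \<open>The image is a subgroup containing \<open>S\<close>, hence contains all that
  \<open>S\<close> generates; with the assumed converse inclusion, the injective homomorphism is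
  onto the generated subgroup.\<close>

lemma (in group) iso_subgroup_generated:
  assumes "h \<in> hom H G" "group H" "inj_on h (carrier H)"
    and "h ` carrier H \<subseteq> generate G S" "S \<subseteq> h ` carrier H"
  shows "h \<in> iso H (subgroup_generated G S)"
proof -
  interpret h: group_hom H G h
    using assms by (simp add: group_hom_def group_hom_axioms_def is_group)
  have "h ` carrier H \<subseteq> carrier G" by auto
  with assms have S: "S \<subseteq> carrier G" by blast
  have "generate G S \<subseteq> h ` carrier H"
    using assms h.img_is_subgroup by (intro generate_subgroup_incl) auto
  with assms S have "carrier (subgroup_generated G S) = h ` carrier H"
    by (auto simp: carrier_subgroup_generated Int_absorb1)
  with assms show ?thesis
    by (auto simp: iso_def bij_betw_def hom_def)
qed

section \<open>The symmetric group on three letters and its presentation\<close>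

lemma sym_group_3_cases:
  assumes "p \<in> carrier (sym_group 3)"
  obtains "p 1 = 1" "p 2 = 2" "p 3 = 3" | "p 1 = 2" "p 2 = 1" "p 3 = 3" | "p 1 = 1" "p 2 = 3" "p 3 = 2"
    | "p 1 = 2" "p 2 = 3" "p 3 = 1" | "p 1 = 3" "p 2 = 1" "p 3 = 2" | "p 1 = 3" "p 2 = 2" "p 3 = 1"
proof -
  have p: "p permutes {1..3}"
    using assms by (simp add: sym_group_carrier)
  have set3: "{1..3::nat} = {1, 2, 3}"
    by auto
  have "p 1 \<in> {1, 2, 3}" "p 2 \<in> {1, 2, 3}" "p 3 \<in> {1, 2, 3}"
    using permutes_in_image[OF p] unfolding set3 by auto
  moreover have "p 1 \<noteq> p 2" "p 1 \<noteq> p 3" "p 2 \<noteq> p 3"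
    using permutes_inj[OF p] by (simp_all add: inj_eq)
  ultimately show ?thesis using that by auto
qed

lemma carrier_integer_mod_group_2: "carrier (integer_mod_group 2) = {0, 1}"
  by (auto simp: carrier_integer_mod_group)

lemma sym_group_3_eqI:
  assumes "p \<in> carrier (sym_group 3)" "q \<in> carrier (sym_group 3)" "p 1 = q 1" "p 2 = q 2"
  shows "p = q"
proof
  fix x :: nat
  have "x \<in> {1, 2, 3} \<or> x \<notin> {1..3}" by auto
  moreover have "p 3 = q 3"
    using assms(3,4) by (rule_tac sym_group_3_cases[OF assms(1)];
      rule_tac sym_group_3_cases[OF assms(2)]; simp)
  ultimately show "p x = q x"
    using assms by (auto simp: sym_group_carrier permutes_def)
qed

abbreviation "s12 \<equiv> Transposition.transpose 1 (2::nat)"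
abbreviation "s23 \<equiv> Transposition.transpose 2 (3::nat)"

lemma transpositions_in_sym_group_3: "s12 \<in> carrier (sym_group 3)" "s23 \<in> carrier (sym_group 3)"
  by (simp_all add: sym_group_carrier permutes_swap_id)

text \<open>The reduced word of \<open>p\<close> with \<open>a\<close> for \<open>s12\<close> and
  \<open>b\<close> for \<open>s23\<close>, recognised from the values at 1 and 2. Only the longest
  element has two reduced words, and \<open>a b a\<close> is the one chosen.\<close>

definition coxeter_word :: "('a, 'b) monoid_scheme \<Rightarrow> 'a \<Rightarrow> 'a \<Rightarrow> (nat \<Rightarrow> nat) \<Rightarrow> 'a" where
  "coxeter_word G a b p =
     (if p 1 = 1 then (if p 2 = 2 then \<one>\<^bsub>G\<^esub> else b)
      else if p 1 = 2 then (if p 2 = 1 then a else a \<otimes>\<^bsub>G\<^esub> b)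
      else if p 2 = 1 then b \<otimes>\<^bsub>G\<^esub> a else a \<otimes>\<^bsub>G\<^esub> (b \<otimes>\<^bsub>G\<^esub> a))"

locale s3_relations = group G for G (structure) +
  fixes a b
  assumes a [simp]: "a \<in> carrier G" and b [simp]: "b \<in> carrier G"
    and aa: "a \<otimes> a = \<one>" and bb: "b \<otimes> b = \<one>" and bab: "b \<otimes> (a \<otimes> b) = a \<otimes> (b \<otimes> a)"
begin

text \<open>The relations with a trailing factor, for use inside right-nested products. Together
  with the bare relations they reduce every word in \<open>a\<close> and \<open>b\<close> to one of
  the six words of \<open>coxeter_word\<close>.\<close>

lemma generator_simps:
  assumes [simp]: "x \<in> carrier G"
  shows "a \<otimes> (a \<otimes> x) = x" "b \<otimes> (b \<otimes> x) = x" "b \<otimes> (a \<otimes> (b \<otimes> x)) = a \<otimes> (b \<otimes> (a \<otimes> x))"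
proof -
  show "a \<otimes> (a \<otimes> x) = x" "b \<otimes> (b \<otimes> x) = x"
    by (simp_all add: aa bb flip: m_assoc)
  have "b \<otimes> (a \<otimes> (b \<otimes> x)) = (b \<otimes> (a \<otimes> b)) \<otimes> x"
    by (simp add: m_assoc)
  then show "b \<otimes> (a \<otimes> (b \<otimes> x)) = a \<otimes> (b \<otimes> (a \<otimes> x))"
    by (simp add: bab m_assoc)
qed

text \<open>There are 36 pairs. In each, the product of the two reduced words is rewritten to the
  reduced word of the composite.\<close>

lemma coxeter_word_hom: "coxeter_word G a b \<in> hom (sym_group 3) G"
proof (rule homI)
  fix p q assume pq: "p \<in> carrier (sym_group 3)" "q \<in> carrier (sym_group 3)"
  show "coxeter_word G a b (p \<otimes>\<^bsub>sym_group 3\<^esub> q) = coxeter_word G a b p \<otimes> coxeter_word G a b q"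
    by (rule sym_group_3_cases[OF pq(1)]; rule sym_group_3_cases[OF pq(2)];
      simp add: coxeter_word_def sym_group_mult m_assoc aa bb bab generator_simps)
qed (simp add: coxeter_word_def)

lemma coxeter_word_generators: "coxeter_word G a b s12 = a" "coxeter_word G a b s23 = b"
  by (simp_all add: coxeter_word_def Transposition.transpose_def)

lemma coxeter_word_generate: "a \<in> S \<Longrightarrow> b \<in> S \<Longrightarrow> coxeter_word G a b p \<in> generate G S"
  by (auto simp: coxeter_word_def intro: generate.intros)

text \<open>The kernel is trivial: \<open>b = \<one>\<close> would turn the braid relation into
  \<open>a = a a = \<one>\<close>, a trivial \<open>a b\<close> or \<open>b a\<close> would give
  \<open>a = b\<close>, and a trivial \<open>a b a\<close> would give
  \<open>b = \<one>\<close>.\<close>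

lemma coxeter_word_inj:
  assumes "a \<noteq> \<one>" "a \<noteq> b"
  shows "inj_on (coxeter_word G a b) (carrier (sym_group 3))"
proof -
  have "b \<noteq> \<one>"
    using bab aa \<open>a \<noteq> \<one>\<close> by auto
  moreover have "a \<otimes> b \<noteq> \<one>" "b \<otimes> a \<noteq> \<one>"
    using \<open>a \<noteq> b\<close> aa bb by (metis a b l_cancel r_cancel)+
  moreover have "a \<otimes> (b \<otimes> a) \<noteq> \<one>"
    using \<open>b \<noteq> \<one>\<close> by (metis a b aa l_cancel m_closed r_cancel_one)
  ultimately have "p = \<one>\<^bsub>sym_group 3\<^esub>"
    if "p \<in> carrier (sym_group 3)" "coxeter_word G a b p = \<one>" for p
    using that assms(1)
    by (rule_tac sym_group_3_cases[OF that(1)])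
      (auto simp: coxeter_word_def sym_group_one intro!: sym_group_3_eqI
        simp: sym_group_carrier permutes_id)
  then show ?thesis
    by (subst inj_on_one_iff'[OF coxeter_word_hom sym_group_is_group is_group]) simp
qed

lemma coxeter_word_iso:
  assumes "a \<noteq> \<one>" "a \<noteq> b"
  shows "coxeter_word G a b \<in> iso (sym_group 3) (subgroup_generated G {a, b})"
proof (intro iso_subgroup_generated coxeter_word_hom sym_group_is_group coxeter_word_inj assms)
  show "{a, b} \<subseteq> coxeter_word G a b ` carrier (sym_group 3)"
    using coxeter_word_generators transpositions_in_sym_group_3 by (metis empty_subsetI imageI insert_subset)
qed (auto intro: coxeter_word_generate)

end

section \<open>Adjoining a central involution\<close>

locale s3_z2_relations = s3_relations G a b for G (structure) and a b +
  fixes t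
  assumes t [simp]: "t \<in> carrier G" and tt: "t \<otimes> t = \<one>"
    and ta: "t \<otimes> a = a \<otimes> t" and tb: "t \<otimes> b = b \<otimes> t"
begin

definition "word2 = (\<lambda>(p, k::int). coxeter_word G a b p \<otimes> (if k = 0 then \<one> else t))"

lemma coxeter_word_closed [simp]: "coxeter_word G a b p \<in> carrier G"
  by (simp add: coxeter_word_def)

lemma t_coxeter_word: "t \<otimes> coxeter_word G a b p = coxeter_word G a b p \<otimes> t"
proof -
  have "t \<otimes> (a \<otimes> x) = a \<otimes> (t \<otimes> x)" "t \<otimes> (b \<otimes> x) = b \<otimes> (t \<otimes> x)" if "x \<in> carrier G" for x
    using that by (simp_all add: ta tb flip: m_assoc)
  then show ?thesis
    by (simp add: coxeter_word_def ta tb m_assoc)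
qed

text \<open>The central \<open>t\<close> passes through the word of the second factor, and
  \<open>t t = \<one>\<close> matches addition of exponents modulo 2.\<close>

lemma word2_hom: "word2 \<in> hom (sym_group 3 \<times>\<times> integer_mod_group 2) G"
proof (rule homI)
  fix x y
  assume "x \<in> carrier (sym_group 3 \<times>\<times> integer_mod_group 2)" "y \<in> carrier (sym_group 3 \<times>\<times> integer_mod_group 2)"
  then obtain p k q l where x: "x = (p, k)" and y: "y = (q, l)"
    and pq: "p \<in> carrier (sym_group 3)" "q \<in> carrier (sym_group 3)" and kl: "k = 0 \<or> k = 1" "l = 0 \<or> l = 1"
    by (auto simp: carrier_integer_mod_group_2)
  have "t \<otimes> (coxeter_word G a b q \<otimes> r) = coxeter_word G a b q \<otimes> (t \<otimes> r)" if "r \<in> carrier G" for r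
    using that by (simp add: t_coxeter_word flip: m_assoc)
  with kl show "word2 (x \<otimes>\<^bsub>sym_group 3 \<times>\<times> integer_mod_group 2\<^esub> y) = word2 x \<otimes> word2 y"
    by (auto simp: x y word2_def hom_mult[OF coxeter_word_hom pq] m_assoc tt t_coxeter_word)
qed (auto simp: word2_def)

lemma word2_generators:
  "word2 (s12, 0) = a" "word2 (s23, 0) = b" "word2 (id, 1) = t"
  using coxeter_word_generators by (simp_all add: word2_def coxeter_word_def)

lemma group_s3_z2: "group (sym_group 3 \<times>\<times> integer_mod_group 2)"
  by (intro DirProd_group sym_group_is_group group_integer_mod_group)

lemma generators_in_carrier:
  "(s12, 0) \<in> carrier (sym_group 3 \<times>\<times> integer_mod_group 2)"
  "(s23, 0) \<in> carrier (sym_group 3 \<times>\<times> integer_mod_group 2)"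
  "(id, 1) \<in> carrier (sym_group 3 \<times>\<times> integer_mod_group 2)"
  using transpositions_in_sym_group_3
  by (simp_all add: sym_group_carrier permutes_id)

text \<open>Given injectivity on \<open>S_3\<close>, a kernel element with exponent 1 would place
  \<open>t\<close> in the image of \<open>S_3\<close>; this is the case to exclude.\<close>

lemma word2_inj:
  assumes "a \<noteq> \<one>" "a \<noteq> b" "t \<noteq> \<one>"
  shows "inj_on word2 (carrier (sym_group 3 \<times>\<times> integer_mod_group 2))"
proof -
  note inj = inj_onD[OF coxeter_word_inj[OF assms(1,2)]]
  have one: "\<one>\<^bsub>sym_group 3\<^esub> \<in> carrier (sym_group 3)" "coxeter_word G a b \<one>\<^bsub>sym_group 3\<^esub> = \<one>"
    by (simp_all add: sym_group_carrier sym_group_one permutes_id coxeter_word_def)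
  have "p = \<one>\<^bsub>sym_group 3\<^esub> \<and> k = 0"
    if p: "p \<in> carrier (sym_group 3)" and k: "k = 0 \<or> k = 1" and eq: "word2 (p, k) = \<one>" for p k
  proof (cases "k = 0")
    case True
    with eq inj[of p "\<one>\<^bsub>sym_group 3\<^esub>"] p one show ?thesis
      by (simp add: word2_def)
  next
    case False
    with eq have "coxeter_word G a b p \<otimes> t = t \<otimes> t"
      by (simp add: word2_def tt)
    then have cw: "coxeter_word G a b p = t"
      by (simp only: r_cancel coxeter_word_closed t)
    \<comment> \<open>The centre of \<open>S\<^sub>3\<close> is trivial, so a central element in the image would be \<open>\<one>\<close>.\<close>
    then have "coxeter_word G a b (p \<circ> s) = coxeter_word G a b (s \<circ> p)"
      if "s \<in> carrier (sym_group 3)" for s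
      using hom_mult[OF coxeter_word_hom p that] hom_mult[OF coxeter_word_hom that p] t_coxeter_word[of s] cw
      by (simp add: sym_group_mult)
    then have "p \<circ> s = s \<circ> p" if "s \<in> carrier (sym_group 3)" for s
      using that p group.is_monoid[OF sym_group_is_group, of 3] monoid.m_closed[of "sym_group 3"]
      by (intro inj) (auto simp: sym_group_mult)
    from this[OF transpositions_in_sym_group_3(1)] this[OF transpositions_in_sym_group_3(2)]
    \<comment> \<open>The second equation says that \<open>s23\<close> fixes \<open>p 1\<close>, so
      \<open>p 1 = 1\<close>; the first then gives \<open>p 2 = 2\<close>.\<close>
    have "p (s12 1) = s12 (p 1)" "p (s23 1) = s23 (p 1)" "p (s12 3) = s12 (p 3)"
      by (metis o_apply)+
    then have "p 1 = 1 \<and> p 2 = 2"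
      by (rule_tac sym_group_3_cases[OF p]) (simp_all add: Transposition.transpose_def)
    then have "t = \<one>"
      using cw by (simp add: coxeter_word_def)
    with \<open>t \<noteq> \<one>\<close> show ?thesis by simp
  qed
  then show ?thesis
    by (subst inj_on_one_iff'[OF word2_hom group_s3_z2 is_group])
      (auto simp: carrier_integer_mod_group_2)
qed

lemma word2_iso:
  assumes "a \<noteq> \<one>" "a \<noteq> b" "t \<noteq> \<one>"
  shows "word2 \<in> iso (sym_group 3 \<times>\<times> integer_mod_group 2) (subgroup_generated G {a, b, t})"
proof (intro iso_subgroup_generated word2_hom group_s3_z2 word2_inj assms)
  show "{a, b, t} \<subseteq> word2 ` carrier (sym_group 3 \<times>\<times> integer_mod_group 2)"
    using word2_generators generators_in_carrier by (metis empty_subsetI imageI insert_subset)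
  show "word2 ` carrier (sym_group 3 \<times>\<times> integer_mod_group 2) \<subseteq> generate G {a, b, t}"
    by (auto simp: word2_def intro!: generate.eng coxeter_word_generate intro: generate.intros)
qed

end

section \<open>Distinctness and reversal of the systems\<close>

lemma cst_0: "cst 0 = 0"
  by (simp add: cst_def)

text \<open>Distinctness lets an index be recovered from its system, so that permutations of indices
  define maps on the set of systems. A few coefficients at one specialisation already tell the 18
  systems apart.\<close>

lemma inj_on_P6: "inj_on P6 {1..18}"
proof -
  \<comment> \<open>At zero parameters the first right-hand side is \<open>p + z q\<close>, and
    \<open>z = 2\<close> gives \<open>p\<close> and \<open>q\<close> different weights. The
    coefficients recorded are those of \<open>u^2 v\<close>, \<open>u v\<close> and
    \<open>u v u\<close>.\<close>
  define key where "key S = map (Poly_Mapping.lookup (fst (S (0, 0, 0, 0) 2)))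
    [Word [U, U, V], Word [U, V], Word [U, V, U]]" for S :: system
  have single_mult: "cst c * Poly_Mapping.single w d = Poly_Mapping.single w (c * d)"
    "Poly_Mapping.single (Word xs) c * Poly_Mapping.single (Word ys) d = Poly_Mapping.single (Word (xs @ ys)) (c * d)"
    for c d w xs ys
    by (simp add: cst_def mult_single, simp add: mult_single plus_word_def)
  have "key (P6 1) = [0, 0, - 3]" "key (P6 2) = [0, 2, - 5]" "key (P6 3) = [0, 2, - 4]"
    "key (P6 4) = [0, 0, - 2]" "key (P6 5) = [0, 0, - 1]" "key (P6 6) = [0, 2, - 3]"
    "key (P6 7) = [- 1, 2, - 3]" "key (P6 8) = [0, 0, - 4]" "key (P6 9) = [- 1, 4, - 5]"
    "key (P6 10) = [- 2, 2, - 3]" "key (P6 11) = [- 2, 4, - 4]" "key (P6 12) = [0, 0, - 5]"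
    "key (P6 13) = [- 3, 4, - 3]" "key (P6 14) = [- 2, 2, - 4]" "key (P6 15) = [- 1, 2, - 5]"
    "key (P6 16) = [- 4, 4, - 2]" "key (P6 17) = [- 5, 4, - 1]" "key (P6 18) = [- 3, 2, - 3]"
    by ((simp add: key_def P6_def pqrs_table_def Let_def;
        simp only: var_def power2_eq_square power3_eq_cube expand_products mult_2 single_mult append.simps;
        simp add: lookup_add lookup_minus lookup_single cst_0)+)
  then have "distinct (map (key \<circ> P6) [1, 2, 3, 4, 5, 6, 7, 8, 9, 10, 11, 12, 13, 14, 15, 16, 17, 18])"
    by simp
  then have "inj_on (key \<circ> P6) (set [1, 2, 3, 4, 5, 6, 7, 8, 9, 10, 11, 12, 13, 14, 15, 16, 17, 18])"
    by (simp only: distinct_map)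
  then have "inj_on (key \<circ> P6) {1..18}"
  proof (rule inj_on_subset, intro subsetI)
    fix m :: nat assume "m \<in> {1..18}"
    from index_cases[OF this] show "m \<in> set [1, 2, 3, 4, 5, 6, 7, 8, 9, 10, 11, 12, 13, 14, 15, 16, 17, 18]"
      by simp
  qed
  then show ?thesis
    by (rule inj_on_imageI2)
qed

text \<open>Reversal exchanges \<open>E1\<close> with \<open>E4\<close> and \<open>E2\<close> with
  \<open>E5\<close> and fixes \<open>E3\<close>, which explains how \<open>perm_tau\<close> pairs
  the families of the table.\<close>

lemma rev_system_P6:
  assumes "m \<in> {1..18}"
  shows "rev_system (P6 m) = P6 (perm_tau m)"
proof (intro ext)
  fix \<kappa> :: params and z
  obtain \<kappa>1 \<kappa>2 \<kappa>3 \<kappa>4 where \<kappa>: "\<kappa> = (\<kappa>1, \<kappa>2, \<kappa>3, \<kappa>4)"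
    by (cases \<kappa>)
  \<comment> \<open>Reversal leaves constants at the right end; they are moved back to the front,
    with \<open>z\<close> ahead of the parameters.\<close>
  note central = cst_commute[of "var U"] cst_commute[of "var V"]
    cst_left_commute[of "var U"] cst_left_commute[of "var V"]
    cst_commute[of "cst \<kappa>4" z] cst_left_commute[of "cst \<kappa>4" z]
    cst_commute[of "cst (\<kappa>1 - \<kappa>2 - \<kappa>4)" z]
  show "rev_system (P6 m) \<kappa> z = P6 (perm_tau m) \<kappa> z"
    using index_cases[OF assms]
    by (elim disjE;
        simp add: \<kappa> rev_system_def perm_tau_def Transposition.transpose_def P6_def pqrs_table_def Let_def;
        simp only: nc_rev_add nc_rev_diff nc_rev_uminus nc_rev_mult nc_rev_cst nc_rev_var
          nc_rev_numeral power2_eq_square power3_eq_cube;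
        simp only: expand_products mult_2 mult_2_right central;
        simp only: move_negatives;
        simp only: add_ac)
qed

section \<open>The group of transformations\<close>

lemma BijGroup_simps:
  "carrier (BijGroup S) = Bij S" "\<one>\<^bsub>BijGroup S\<^esub> = (\<lambda>x\<in>S. x)"
  "f \<in> Bij S \<Longrightarrow> g \<in> Bij S \<Longrightarrow> f \<otimes>\<^bsub>BijGroup S\<^esub> g = compose S f g"
  by (simp_all add: BijGroup_def)

lemma Bij_involution:
  assumes "f \<in> extensional S" "\<And>x. x \<in> S \<Longrightarrow> f x \<in> S" "\<And>x. x \<in> S \<Longrightarrow> f (f x) = x"
  shows "f \<in> Bij S" "f \<otimes>\<^bsub>BijGroup S\<^esub> f = \<one>\<^bsub>BijGroup S\<^esub>"
proof -
  show f: "f \<in> Bij S"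
    using assms bij_betwI[of f S S f] by (auto simp: Bij_def)
  show "f \<otimes>\<^bsub>BijGroup S\<^esub> f = \<one>\<^bsub>BijGroup S\<^esub>"
    using assms(3) by (auto simp: BijGroup_simps f compose_def)
qed

lemma r1_Bij: "r1 scl \<in> Bij points" "r1 scl \<otimes>\<^bsub>BijGroup points\<^esub> r1 scl = \<one>\<^bsub>BijGroup points\<^esub>"
proof -
  have "r1 scl \<in> extensional points"
    by (simp add: r1_def)
  note * = Bij_involution[OF this]
  show "r1 scl \<in> Bij points" "r1 scl \<otimes>\<^bsub>BijGroup points\<^esub> r1 scl = \<one>\<^bsub>BijGroup points\<^esub>"
    by (rule *; simp add: r1_involution)+
qed

lemma (in complex_algebra) r2_Bij:
  "r2 scl \<in> Bij points" "r2 scl \<otimes>\<^bsub>BijGroup points\<^esub> r2 scl = \<one>\<^bsub>BijGroup points\<^esub>"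
proof -
  have "r2 scl \<in> extensional points"
    by (simp add: r2_def)
  note * = Bij_involution[OF this]
  show "r2 scl \<in> Bij points" "r2 scl \<otimes>\<^bsub>BijGroup points\<^esub> r2 scl = \<one>\<^bsub>BijGroup points\<^esub>"
    by (rule *; simp add: r2_involution)+
qed

text \<open>On the variable, both composites are \<open>z / (z - 1)\<close>. On the parameters, both
  fix the second one and send the fourth to
  \<open>2 \<kappa>1 - \<kappa>2 - \<kappa>4 + 1\<close>.\<close>

lemma (in complex_algebra) r_braid:
  assumes "p \<in> points"
  shows "r2 scl (r1 scl (r2 scl p)) = r1 scl (r2 scl (r1 scl p))"
  using assms
proof (rule points_cases)
  fix z u v \<kappa>1 \<kappa>2 \<kappa>3 \<kappa>4
  assume p: "p = (z, u, v, \<kappa>1, \<kappa>2, \<kappa>3, \<kappa>4)" and z: "z \<noteq> 0" "z \<noteq> 1"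
  \<comment> \<open>These are the scalars \<open>z / (z - 1)\<close> and \<open>1 / (1 - z)\<close>
    by which \<open>r2\<close> acts last on one side and in the middle on the other;
    \<open>c = 1 - d\<close> reconciles the two results for \<open>u\<close>.\<close>
  define c d where "c = inverse (1 - inverse z)" and "d = inverse (1 - z)"
  have cd: "c * inverse z = - d" "c = 1 - d" "(1 - inverse z) * z = - (1 - z)"
    using z by (simp_all add: c_def d_def field_simps)
  have nz: "inverse z \<noteq> 0" "inverse z \<noteq> 1" "1 - inverse z \<noteq> 0" "1 - inverse z \<noteq> 1"
    "1 - z \<noteq> 0" "1 - z \<noteq> 1" "d \<noteq> 0" "d \<noteq> 1"
    using z by (auto simp: d_def inverse_eq_1_iff)
  have "scl c (1 - scl (inverse z) u) = scl c 1 - scl (c * inverse z) u"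
    by (simp add: scale_right_diff_distrib)
  also have "\<dots> = 1 - scl d (1 - u)"
    unfolding cd(1) by (simp add: cd(2) scale_right_diff_distrib scale_left_diff_distrib)
  finally have u: "scl c (1 - scl (inverse z) u) = 1 - scl d (1 - u)" .
  have "scl (1 - inverse z) (- scl z v) = - scl ((1 - inverse z) * z) v"
    by simp
  also have "\<dots> = - scl (1 - z) (- v)"
    unfolding cd(3) by (simp only: scale_minus_left scale_minus_right)
  finally have v: "scl (1 - inverse z) (- scl z v) = - scl (1 - z) (- v)" .
  show ?thesis
    using u v cd(2) by (simp add: p r1_simps r2_simps z nz flip: c_def d_def)
qed

lemma (in complex_algebra) r_relations: "s3_relations (BijGroup points) (r1 scl) (r2 scl)"
proof (intro s3_relations.intro s3_relations_axioms.intro group_BijGroup)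
  show "r2 scl \<otimes>\<^bsub>BijGroup points\<^esub> (r1 scl \<otimes>\<^bsub>BijGroup points\<^esub> r2 scl) =
      r1 scl \<otimes>\<^bsub>BijGroup points\<^esub> (r2 scl \<otimes>\<^bsub>BijGroup points\<^esub> r1 scl)"
    using r_braid by (simp add: BijGroup_simps r1_Bij r2_Bij compose_Bij) (auto simp: compose_def)
qed (simp_all add: BijGroup_simps(1) r1_Bij r2_Bij)

lemma (in complex_algebra) r_distinct: "r1 scl \<noteq> \<one>\<^bsub>BijGroup points\<^esub>" "r1 scl \<noteq> r2 scl"
proof -
  \<comment> \<open>The variable alone separates the maps, whatever the algebra: 3 goes to -2 under
    \<open>r1\<close> and to 1/3 under \<open>r2\<close>.\<close>
  let ?p = "(3, 0, 0, 0, 0, 0, 0) :: 'a point"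
  have "?p \<in> points" by (simp add: points_def)
  moreover have "fst (r1 scl ?p) = - 2" "fst (r2 scl ?p) = 1 / 3"
    by (simp_all add: r1_simps r2_simps)
  ultimately show "r1 scl \<noteq> \<one>\<^bsub>BijGroup points\<^esub>" "r1 scl \<noteq> r2 scl"
    by (auto simp: BijGroup_simps)
qed

lemma (in complex_algebra) r_group_iso: "r_group scl \<cong> sym_group 3"
proof -
  interpret s3_relations "BijGroup points" "r1 scl" "r2 scl"
    by (rule r_relations)
  show ?thesis
    using group.iso_set_sym[OF sym_group_is_group coxeter_word_iso[OF r_distinct]]
    by (auto simp: is_iso_def r_group_def)
qed

section \<open>The transposition and the full group\<close>

lemma transposition_simps:
  "z \<noteq> 0 \<Longrightarrow> z \<noteq> 1 \<Longrightarrow> transposition (z, u, v, \<kappa>) = (z, nc_rev u, nc_rev v, \<kappa>)"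
  by (simp add: transposition_def points_def)

lemma transposition_Bij: "transposition \<in> Bij points"
  "transposition \<otimes>\<^bsub>BijGroup points\<^esub> transposition = \<one>\<^bsub>BijGroup points\<^esub>"
proof -
  have "transposition \<in> extensional points"
    by (simp add: transposition_def)
  note * = Bij_involution[OF this]
  show "transposition \<in> Bij points"
    "transposition \<otimes>\<^bsub>BijGroup points\<^esub> transposition = \<one>\<^bsub>BijGroup points\<^esub>"
    by (rule *; auto simp: transposition_def points_def nc_rev_nc_rev)+
qed

lemma transposition_neq_one: "transposition \<noteq> \<one>\<^bsub>BijGroup points\<^esub>"
proof -
  \<comment> \<open>Reversal fixes constants and single letters, so a product of the two letters
    serves as witness; \<open>z = 2\<close> avoids 0 and 1.\<close>
  let ?p = "(2, var U * var V, 0, 0, 0, 0, 0) :: ncpoly point"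
  have "?p \<in> points" by (simp add: points_def)
  moreover have "var V * var U \<noteq> var U * var V"
    by (auto simp: var_def mult_single plus_word_def lookup_single when_def
        dest!: arg_cong[where f = "\<lambda>f. Poly_Mapping.lookup f (Word [U, V])"])
  then have "transposition ?p \<noteq> ?p"
    by (simp add: transposition_simps nc_rev_mult)
  ultimately show ?thesis
    unfolding BijGroup_simps by (metis restrict_apply')
qed

interpretation nc: complex_algebra nc_scale
  by (rule complex_algebra_nc_scale)

lemma transposition_r1:
  "transposition \<otimes>\<^bsub>BijGroup points\<^esub> r1 nc_scale = r1 nc_scale \<otimes>\<^bsub>BijGroup points\<^esub> transposition"
  by (auto simp: BijGroup_simps transposition_Bij r1_Bij compose_def fun_eq_iff r1_simps
      transposition_simps nc_rev_diff nc_rev_uminus elim!: points_cases)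

lemma transposition_r2:
  "transposition \<otimes>\<^bsub>BijGroup points\<^esub> r2 nc_scale = r2 nc_scale \<otimes>\<^bsub>BijGroup points\<^esub> transposition"
  by (auto simp: BijGroup_simps transposition_Bij nc.r2_Bij compose_def fun_eq_iff r2_simps
      transposition_simps nc_rev_scale elim!: points_cases)

interpretation full: s3_z2_relations "BijGroup points" "r1 nc_scale" "r2 nc_scale" transposition
  by (intro s3_z2_relations.intro s3_z2_relations_axioms.intro nc.r_relations)
    (simp_all add: BijGroup_simps(1) transposition_Bij transposition_r1 transposition_r2)

lemma full_word_iso: "full.word2 \<in> iso (sym_group 3 \<times>\<times> integer_mod_group 2) full_group"
  unfolding full_group_def
  by (intro full.word2_iso nc.r_distinct transposition_neq_one)

lemma full_group_iso: "full_group \<cong> sym_group 3 \<times>\<times> integer_mod_group 2"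
  using group.iso_set_sym[OF full.group_s3_z2 full_word_iso] by (auto simp: is_iso_def)

section \<open>The action on the systems\<close>

declare One_nat_def [simp del] \<comment> \<open>it would rewrite \<open>{1..18}\<close> to \<open>{Suc 0..18}\<close>\<close>

text \<open>Carries a permutation of indices over to the systems themselves. The restriction makes
  it extensional, as membership in \<open>BijGroup\<close> demands.\<close>

definition system_perm :: "(nat \<Rightarrow> nat) \<Rightarrow> system \<Rightarrow> system" where
  "system_perm \<sigma> = (\<lambda>S\<in>P6 ` {1..18}. P6 (\<sigma> (inv_into {1..18} P6 S)))"

lemma system_perm_P6: "m \<in> {1..18} \<Longrightarrow> system_perm \<sigma> (P6 m) = P6 (\<sigma> m)"
  by (simp add: system_perm_def inv_into_f_f[OF inj_on_P6])

lemma system_perm_Bij: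
  assumes "\<And>m. m \<in> {1..18} \<Longrightarrow> \<sigma> m \<in> {1..18} \<and> \<sigma> (\<sigma> m) = m"
  shows "system_perm \<sigma> \<in> Bij (P6 ` {1..18})"
    "system_perm \<sigma> \<otimes>\<^bsub>BijGroup (P6 ` {1..18})\<^esub> system_perm \<sigma> = \<one>\<^bsub>BijGroup (P6 ` {1..18})\<^esub>"
proof -
  have "system_perm \<sigma> \<in> extensional (P6 ` {1..18})"
    by (simp add: system_perm_def)
  note * = Bij_involution[OF this]
  show "system_perm \<sigma> \<in> Bij (P6 ` {1..18})"
    "system_perm \<sigma> \<otimes>\<^bsub>BijGroup (P6 ` {1..18})\<^esub> system_perm \<sigma> = \<one>\<^bsub>BijGroup (P6 ` {1..18})\<^esub>"
    by (rule *; use assms in \<open>force simp: system_perm_P6 simp del: atLeastAtMost_iff\<close>)+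
qed

lemma system_perms_Bij:
  assumes "\<sigma> = perm_r1 \<or> \<sigma> = perm_r2 \<or> \<sigma> = perm_tau"
  shows "system_perm \<sigma> \<in> Bij (P6 ` {1..18})"
    "system_perm \<sigma> \<otimes>\<^bsub>BijGroup (P6 ` {1..18})\<^esub> system_perm \<sigma> = \<one>\<^bsub>BijGroup (P6 ` {1..18})\<^esub>"
  using assms by (auto intro!: system_perm_Bij simp: perm_relations simp del: atLeastAtMost_iff)

interpretation sys: s3_z2_relations "BijGroup (P6 ` {1..18})"
  "system_perm perm_r1" "system_perm perm_r2" "system_perm perm_tau"
proof (intro s3_z2_relations.intro s3_relations.intro s3_relations_axioms.intro
    s3_z2_relations_axioms.intro group_BijGroup)
  show "system_perm perm_r2 \<otimes>\<^bsub>BijGroup (P6 ` {1..18})\<^esub>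
      (system_perm perm_r1 \<otimes>\<^bsub>BijGroup (P6 ` {1..18})\<^esub> system_perm perm_r2) =
    system_perm perm_r1 \<otimes>\<^bsub>BijGroup (P6 ` {1..18})\<^esub>
      (system_perm perm_r2 \<otimes>\<^bsub>BijGroup (P6 ` {1..18})\<^esub> system_perm perm_r1)"
    by (simp add: BijGroup_simps system_perms_Bij compose_Bij)
      (auto simp: compose_def fun_eq_iff system_perm_P6 perm_relations simp del: atLeastAtMost_iff)
  show "system_perm perm_tau \<otimes>\<^bsub>BijGroup (P6 ` {1..18})\<^esub> system_perm perm_r1 =
      system_perm perm_r1 \<otimes>\<^bsub>BijGroup (P6 ` {1..18})\<^esub> system_perm perm_tau"
    "system_perm perm_tau \<otimes>\<^bsub>BijGroup (P6 ` {1..18})\<^esub> system_perm perm_r2 =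
      system_perm perm_r2 \<otimes>\<^bsub>BijGroup (P6 ` {1..18})\<^esub> system_perm perm_tau"
    by (auto simp: BijGroup_simps system_perms_Bij compose_def fun_eq_iff system_perm_P6 perm_relations
        simp del: atLeastAtMost_iff)
qed (simp_all add: BijGroup_simps(1) system_perms_Bij del: atLeastAtMost_iff)

definition system_action :: "(ncpoly point \<Rightarrow> ncpoly point) \<Rightarrow> system \<Rightarrow> system" where
  "system_action = sys.word2 \<circ> inv_into (carrier (sym_group 3 \<times>\<times> integer_mod_group 2)) full.word2"

text \<open>The generators are the values of \<open>full.word2\<close> at \<open>(s12, 0)\<close>,
  \<open>(s23, 0)\<close> and \<open>(id, 1)\<close>, where its inverse is explicit;
  \<open>sys.word2\<close> has the corresponding permutations as values there.\<close>

lemma system_action_generators: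
  "system_action (r1 nc_scale) = system_perm perm_r1"
  "system_action (r2 nc_scale) = system_perm perm_r2"
  "system_action transposition = system_perm perm_tau"
proof -
  have "system_action (full.word2 x) = sys.word2 x" if "x \<in> carrier (sym_group 3 \<times>\<times> integer_mod_group 2)" for x
    using full.word2_inj[OF nc.r_distinct transposition_neq_one] that
    by (simp add: system_action_def inv_into_f_f)
  from this[OF full.generators_in_carrier(1)] this[OF full.generators_in_carrier(2)]
    this[OF full.generators_in_carrier(3)]
  show "system_action (r1 nc_scale) = system_perm perm_r1"
    "system_action (r2 nc_scale) = system_perm perm_r2"
    "system_action transposition = system_perm perm_tau"
    by (simp_all only: full.word2_generators sys.word2_generators)
qed

interpretation act: group_action full_group "P6 ` {1..18}" system_action
proof (intro group_action.intro group_hom.intro group_hom_axioms.intro group_BijGroup)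
  show "Group.group full_group"
    by (simp add: full_group_def group.group_subgroup_generated group_BijGroup)
  have "inv_into (carrier (sym_group 3 \<times>\<times> integer_mod_group 2)) full.word2
      \<in> hom full_group (sym_group 3 \<times>\<times> integer_mod_group 2)"
    using group.iso_set_sym[OF full.group_s3_z2 full_word_iso] by (simp add: iso_def)
  then show "system_action \<in> hom full_group (BijGroup (P6 ` {1..18}))"
    unfolding system_action_def by (rule hom_compose[OF _ sys.word2_hom])
qed

lemma generators_in_full_group:
  "r1 nc_scale \<in> carrier full_group" "r2 nc_scale \<in> carrier full_group" "transposition \<in> carrier full_group"
  by (auto simp: full_group_def carrier_subgroup_generated BijGroup_simps r1_Bij nc.r2_Bij
      transposition_Bij intro: generate.incl)

section \<open>Orbits of the action\<close>

lemma orbit_step: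
  assumes "x \<in> P6 ` {1..18}" "m \<in> {1..18}" "P6 m \<in> orbit full_group system_action x"
  shows "P6 (perm_r1 m) \<in> orbit full_group system_action x"
    "P6 (perm_r2 m) \<in> orbit full_group system_action x"
    "P6 (perm_tau m) \<in> orbit full_group system_action x"
proof -
  have "system_action g (P6 m) \<in> orbit full_group system_action x" if g: "g \<in> carrier full_group" for g
  proof -
    obtain h where h: "h \<in> carrier full_group" "P6 m = system_action h x"
      using assms(3) by (auto simp: orbit_def)
    interpret G: group full_group
      by (simp add: full_group_def group.group_subgroup_generated group_BijGroup)
    have "system_action g (P6 m) = system_action (g \<otimes>\<^bsub>full_group\<^esub> h) x"
      using act.composition_rule[OF assms(1) g h(1)] h(2) by simp
    then show ?thesis
      using g h(1) by (auto simp: orbit_def intro!: exI[of _ "g \<otimes>\<^bsub>full_group\<^esub> h"])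
  qed
  from this[OF generators_in_full_group(1)] this[OF generators_in_full_group(2)]
    this[OF generators_in_full_group(3)]
  show "P6 (perm_r1 m) \<in> orbit full_group system_action x"
    "P6 (perm_r2 m) \<in> orbit full_group system_action x"
    "P6 (perm_tau m) \<in> orbit full_group system_action x"
    using assms(2) by (simp_all only: system_action_generators system_perm_P6)
qed

text \<open>The upper bound for orbits: closure of \<open>B\<close> under the generators passes to
  all products by induction over the generated group.\<close>

lemma system_action_invariant:
  assumes B: "B \<subseteq> {1..18}"
    and closed: "\<And>m. m \<in> B \<Longrightarrow> perm_r1 m \<in> B \<and> perm_r2 m \<in> B \<and> perm_tau m \<in> B"
    and g: "g \<in> carrier full_group" and x: "x \<in> P6 ` B"
  shows "system_action g x \<in> P6 ` B"
proof -
  interpret P: group "BijGroup points" by (rule group_BijGroup)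
  have gen: "system_action h y \<in> P6 ` B"
    if h: "h \<in> {r1 nc_scale, r2 nc_scale, transposition}" and "y \<in> P6 ` B" for h y
  proof -
    from \<open>y \<in> P6 ` B\<close> obtain m where m: "m \<in> B" "y = P6 m" by blast
    with B have "m \<in> {1..18}" by blast
    then have "system_action h y \<in> {P6 (perm_r1 m), P6 (perm_r2 m), P6 (perm_tau m)}"
      using h by (elim insertE emptyE; simp only: m system_action_generators system_perm_P6 insert_iff simp_thms)
    with closed[OF m(1)] show ?thesis by blast
  qed
  \<comment> \<open>Each generator is its own inverse, so the inverse case of the induction is the
    generator case again.\<close>
  have inv: "inv\<^bsub>BijGroup points\<^esub> h = h" if "h \<in> {r1 nc_scale, r2 nc_scale, transposition}" for h
    using that by (auto intro!: P.inv_equality simp: r1_Bij nc.r2_Bij transposition_Bij BijGroup_simps(1))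
  have carrier: "carrier full_group = generate (BijGroup points) {r1 nc_scale, r2 nc_scale, transposition}"
    by (simp add: full_group_def carrier_subgroup_generated BijGroup_simps r1_Bij nc.r2_Bij transposition_Bij Int_absorb1)
  have "x \<in> P6 ` B \<longrightarrow> system_action g x \<in> P6 ` B"
    using g unfolding carrier
  proof (induction g arbitrary: x rule: generate.induct)
    case one
    have "system_action \<one>\<^bsub>BijGroup points\<^esub> = (\<lambda>x\<in>P6 ` {1..18}. x)"
      using act.id_eq_one by (simp add: full_group_def)
    then show ?case using B by auto
  next
    case (eng g h)
    show ?case
    proof
      assume "x \<in> P6 ` B"
      with B have "x \<in> P6 ` {1..18}" by auto
      from act.composition_rule[OF this] eng \<open>x \<in> P6 ` B\<close>
      show "system_action (g \<otimes>\<^bsub>BijGroup points\<^esub> h) x \<in> P6 ` B"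
        by (simp add: carrier) (simp add: full_group_def)
    qed
  qed (use gen inv in auto)
  with x show ?thesis by blast
qed

text \<open>\<open>reach\<close> says that all of \<open>B\<close> can be reached from
  \<open>b\<close> by the three permutations, in the form of an induction principle. Taking for
  \<open>Y\<close> the indices whose systems lie in an orbit gives the lower bound; invariance gives
  the upper one.\<close>

lemma orbit_eq:
  assumes B: "B \<subseteq> {1..18}"
    and closed: "\<And>m. m \<in> B \<Longrightarrow> perm_r1 m \<in> B \<and> perm_r2 m \<in> B \<and> perm_tau m \<in> B"
    and b: "b \<in> B"
    and reach: "\<And>Y. b \<in> Y \<Longrightarrow>
      (\<And>m. m \<in> Y \<Longrightarrow> m \<in> B \<Longrightarrow> perm_r1 m \<in> Y \<and> perm_r2 m \<in> Y \<and> perm_tau m \<in> Y) \<Longrightarrow> B \<subseteq> Y"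
    and x: "x \<in> P6 ` B"
  shows "orbit full_group system_action x = P6 ` B"
proof
  show "orbit full_group system_action x \<subseteq> P6 ` B"
    using system_action_invariant[OF B closed _ x] by (auto simp: orbit_def)
  have BE: "P6 ` B \<subseteq> P6 ` {1..18}"
    using B by blast
  have reach_orbit: "P6 ` B \<subseteq> orbit full_group system_action y"
    if "y \<in> P6 ` {1..18}" "P6 b \<in> orbit full_group system_action y" for y
  proof -
    have "B \<subseteq> {m. P6 m \<in> orbit full_group system_action y}"
    proof (rule reach)
      fix m assume "m \<in> {m. P6 m \<in> orbit full_group system_action y}" "m \<in> B"
      with orbit_step[OF that(1), of m] B
      show "perm_r1 m \<in> {m. P6 m \<in> orbit full_group system_action y} \<and>
          perm_r2 m \<in> {m. P6 m \<in> orbit full_group system_action y} \<and>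
          perm_tau m \<in> {m. P6 m \<in> orbit full_group system_action y}"
        by blast
    qed (use that in simp)
    then show ?thesis by blast
  qed
  have Pb: "P6 b \<in> P6 ` {1..18}" "x \<in> P6 ` {1..18}"
    using b x BE by auto
  \<comment> \<open>First the orbit of the base system is shown to contain \<open>x\<close>; by
    symmetry the orbit of \<open>x\<close> contains the base system, hence all of
    \<open>B\<close>.\<close>
  then have "x \<in> orbit full_group system_action (P6 b)"
    using reach_orbit[OF Pb(1) act.orbit_refl[OF Pb(1)]] x by blast
  then show "P6 ` B \<subseteq> orbit full_group system_action x"
    using act.orbit_sym[OF Pb] reach_orbit[OF Pb(2)] by blast
qed

lemma orbits_eq:
  "orbits full_group (P6 ` {1..18}) system_action =
     {P6 ` {1, 2, 3, 13, 14, 15}, P6 ` {4, 5, 6, 16, 17, 18}, P6 ` {7, 8, 9, 10, 11, 12}}"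
proof -
  note perms = perm_r1_def perm_r2_def perm_tau_def Transposition.transpose_def
  have perm_values:
    "map perm_r1 [1, 2, 3, 4, 5, 6, 7, 8, 9, 10, 11, 12, 13, 14, 15, 16, 17, 18] =
       [3, 2, 1, 6, 5, 4, 8, 7, 12, 11, 10, 9, 14, 13, 15, 18, 17, 16]"
    "map perm_r2 [1, 2, 3, 4, 5, 6, 7, 8, 9, 10, 11, 12, 13, 14, 15, 16, 17, 18] =
       [1, 3, 2, 5, 4, 6, 10, 12, 11, 7, 9, 8, 13, 15, 14, 17, 16, 18]"
    "map perm_tau [1, 2, 3, 4, 5, 6, 7, 8, 9, 10, 11, 12, 13, 14, 15, 16, 17, 18] =
       [13, 15, 14, 16, 17, 18, 10, 11, 12, 7, 8, 9, 1, 3, 2, 4, 5, 6]"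
    by (simp_all add: perms)
  have orbit1: "orbit full_group system_action x = P6 ` {1, 2, 3, 13, 14, 15}"
    if "x \<in> P6 ` {1, 2, 3, 13, 14, 15}" for x
  proof (rule orbit_eq[OF _ _ _ _ that, of 1])
    fix Y :: "nat set"
    assume Y: "1 \<in> Y" and step: "\<And>m. m \<in> Y \<Longrightarrow> m \<in> {1, 2, 3, 13, 14, 15} \<Longrightarrow>
      perm_r1 m \<in> Y \<and> perm_r2 m \<in> Y \<and> perm_tau m \<in> Y"
    \<comment> \<open>Reachability by explicit walks: from 1 to 3 and 13, from 3 to 2 and 14, and
      from 14 to 15. The other two blocks are treated alike.\<close>
    from step[of 1] Y perm_values have "3 \<in> Y" "13 \<in> Y" by simp_all
    moreover from step[of 3] step[of 13] this perm_values have "2 \<in> Y" "14 \<in> Y" by simp_all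
    moreover from step[of 14] this perm_values have "15 \<in> Y" by simp_all
    ultimately show "{1, 2, 3, 13, 14, 15} \<subseteq> Y" using Y by simp
  qed (use perm_values in auto)
  have orbit4: "orbit full_group system_action x = P6 ` {4, 5, 6, 16, 17, 18}"
    if "x \<in> P6 ` {4, 5, 6, 16, 17, 18}" for x
  proof (rule orbit_eq[OF _ _ _ _ that, of 4])
    fix Y :: "nat set"
    assume Y: "4 \<in> Y" and step: "\<And>m. m \<in> Y \<Longrightarrow> m \<in> {4, 5, 6, 16, 17, 18} \<Longrightarrow>
      perm_r1 m \<in> Y \<and> perm_r2 m \<in> Y \<and> perm_tau m \<in> Y"
    from step[of 4] Y perm_values have "6 \<in> Y" "5 \<in> Y" "16 \<in> Y" by simp_all
    moreover from step[of 16] this perm_values have "18 \<in> Y" "17 \<in> Y" by simp_all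
    ultimately show "{4, 5, 6, 16, 17, 18} \<subseteq> Y" using Y by simp
  qed (use perm_values in auto)
  have orbit7: "orbit full_group system_action x = P6 ` {7, 8, 9, 10, 11, 12}"
    if "x \<in> P6 ` {7, 8, 9, 10, 11, 12}" for x
  proof (rule orbit_eq[OF _ _ _ _ that, of 7])
    fix Y :: "nat set"
    assume Y: "7 \<in> Y" and step: "\<And>m. m \<in> Y \<Longrightarrow> m \<in> {7, 8, 9, 10, 11, 12} \<Longrightarrow>
      perm_r1 m \<in> Y \<and> perm_r2 m \<in> Y \<and> perm_tau m \<in> Y"
    from step[of 7] Y perm_values have "8 \<in> Y" "10 \<in> Y" by simp_all
    moreover from step[of 8] step[of 10] this perm_values have "12 \<in> Y" "11 \<in> Y" by simp_all
    moreover from step[of 12] this perm_values have "9 \<in> Y" by simp_all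
    ultimately show "{7, 8, 9, 10, 11, 12} \<subseteq> Y" using Y by simp
  qed (use perm_values in auto)
  \<comment> \<open>The orbit map is constant on each block, so the image of a block is a single
    orbit.\<close>
  have image: "orbit full_group system_action ` P6 ` B = {P6 ` B}"
    if "B \<noteq> {}" "\<And>x. x \<in> P6 ` B \<Longrightarrow> orbit full_group system_action x = P6 ` B" for B
  proof -
    have "orbit full_group system_action ` P6 ` B = (\<lambda>_. P6 ` B) ` P6 ` B"
      by (rule image_cong[OF refl that(2)])
    then show ?thesis
      using that(1) by (simp add: image_constant_conv)
  qed
  have image1: "orbit full_group system_action ` P6 ` {1, 2, 3, 13, 14, 15} = {P6 ` {1, 2, 3, 13, 14, 15}}"
    by (rule image[OF insert_not_empty orbit1])
  have image4: "orbit full_group system_action ` P6 ` {4, 5, 6, 16, 17, 18} = {P6 ` {4, 5, 6, 16, 17, 18}}"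
    by (rule image[OF insert_not_empty orbit4])
  have image7: "orbit full_group system_action ` P6 ` {7, 8, 9, 10, 11, 12} = {P6 ` {7, 8, 9, 10, 11, 12}}"
    by (rule image[OF insert_not_empty orbit7])
  have range: "{1..18} = {1, 2, 3, 13, 14, 15} \<union> {4, 5, 6, 16, 17, 18} \<union> {7, 8, 9, 10, 11, 12 :: nat}"
    by (intro equalityI subsetI) (use index_cases in \<open>blast, auto\<close>)
  show ?thesis
    unfolding orbits_def Setcompr_eq_image range image_Un
      image1 image4 image7
    by blast
qed

theorem mainTheorem9:
  fixes scl :: "complex \<Rightarrow> 'a::{ring_1, topological_ab_group_add, t2_space} \<Rightarrow> 'a"
  assumes "topological_complex_algebra scl"
  shows "inj_on P6 {1..18} \<and>
    (\<forall>m\<in>{1..18}.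
       maps_system scl (r1 scl) (P6 m) (P6 (perm_r1 m)) \<and>
       maps_system scl (r2 scl) (P6 m) (P6 (perm_r2 m)) \<and>
       rev_system (P6 m) = P6 (perm_tau m)) \<and>
    {r1 scl, r2 scl} \<subseteq> carrier (BijGroup points) \<and>
    r_group scl \<cong> sym_group 3 \<and>
    {r1 nc_scale, r2 nc_scale, transposition} \<subseteq> carrier (BijGroup points) \<and>
    r_group nc_scale \<cong> sym_group 3 \<and>
    transposition \<otimes>\<^bsub>full_group\<^esub> r1 nc_scale = r1 nc_scale \<otimes>\<^bsub>full_group\<^esub> transposition \<and>
    transposition \<otimes>\<^bsub>full_group\<^esub> r2 nc_scale = r2 nc_scale \<otimes>\<^bsub>full_group\<^esub> transposition \<and>
    full_group \<cong> sym_group 3 \<times>\<times> integer_mod_group 2 \<and>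
    (\<exists>\<phi>. group_action full_group (P6 ` {1..18}) \<phi> \<and>
       (\<forall>m\<in>{1..18}.
          \<phi> (r1 nc_scale) (P6 m) = P6 (perm_r1 m) \<and>
          \<phi> (r2 nc_scale) (P6 m) = P6 (perm_r2 m) \<and>
          \<phi> transposition (P6 m) = P6 (perm_tau m)) \<and>
       orbits full_group (P6 ` {1..18}) \<phi> =
         {P6 ` {1, 2, 3, 13, 14, 15}, P6 ` {4, 5, 6, 16, 17, 18}, P6 ` {7, 8, 9, 10, 11, 12}})"
proof -
  interpret topological_complex_algebra scl
    by (rule assms)
  have "\<exists>\<phi>. group_action full_group (P6 ` {1..18}) \<phi> \<and>
       (\<forall>m\<in>{1..18}.
          \<phi> (r1 nc_scale) (P6 m) = P6 (perm_r1 m) \<and>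
          \<phi> (r2 nc_scale) (P6 m) = P6 (perm_r2 m) \<and>
          \<phi> transposition (P6 m) = P6 (perm_tau m)) \<and>
       orbits full_group (P6 ` {1..18}) \<phi> =
         {P6 ` {1, 2, 3, 13, 14, 15}, P6 ` {4, 5, 6, 16, 17, 18}, P6 ` {7, 8, 9, 10, 11, 12}}"
    using act.group_action_axioms orbits_eq
    by (intro exI[of _ system_action] conjI ballI) (simp_all only: system_action_generators system_perm_P6)
  \<comment> \<open>A generated subgroup keeps the multiplication of the ambient group, so
    commutation in \<open>BijGroup points\<close> is commutation in
    \<open>full_group\<close>.\<close>
  then show ?thesis
    using inj_on_P6 rev_system_P6 maps_system_r1 maps_system_r2 r_group_iso nc.r_group_iso full_group_iso
      transposition_r1 transposition_r2 r1_Bij(1)[of scl] r2_Bij(1) r1_Bij(1)[of nc_scale]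
      nc.r2_Bij(1) transposition_Bij(1)
    by (simp add: BijGroup_simps(1) full_group_def)
qed

end
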